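(* Let $N\in\mathbb{N}$ with $N>1$ and let $\varphi\in H^\infty(\mathbb{T}^N)$. Let $M_\varphi:H^2(\mathbb{T}^N)\to H^2(\mathbb{T}^N)$ be the multiplication operator $M_\varphi f=\varphi f$. Then $M_\varphi$ does not admit a frame with finitely many orbits; that is, there is no finite family $\{f_i\}_{i\in I}\subseteq H^2(\mathbb{T}^N)$ ($I$ finite) such that $\{M_\varphi^n f_i\}_{i\in I,\,n\ge 0}$ is a frame for $H^2(\mathbb{T}^N)$.
   Context: $\mathbb{T}^N=\{\zeta\in\mathbb{C}^N: |\zeta_j|=1 \text{ for all } j\}$ carries its normalized Haar (Lebesgue) measure $d\zeta$. For $f\in L^2(\mathbb{T}^N)$ and $\alpha\in\mathbb{Z}^N$, $\widehat f(\alpha)=\int_{\mathbb{T}^N} f(\zeta)\zeta^{-\alpha}\,d\zeta$, where $\zeta^\alpha=\zeta_1^{\alpha_1}\cdots\zeta_N^{\alpha_N}$. $H^2(\mathbb{T}^N)$ is the closed subspace of $L^2(\mathbb{T}^N)$ of those $f$ with $\widehat f(\alpha)=0$ for all $\alpha\in\mathbb{Z}^N\setminus\mathbb{N}_0^N$, and $H^\infty(\mathbb{T}^N)=L^\infty(\mathbb{T}^N)\cap H^2(\mathbb{T}^N)$. A countable family $\{x_j\}_{j\in\Omega}$ in a Hilbert space $\mathcal{H}$ is a frame for $\mathcal{H}$ if there are constants $A,B>0$ with $A\|y\|^2\le\sum_{j\in\Omega}|\langle y,x_j\rangle|^2\le B\|y\|^2$ for all $y\in\mathcal{H}$. *)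

theory Defs
  imports "HOL-Probability.Probability"
begin

definition circle_haar :: "complex measure" where
  "circle_haar =
     distr (uniform_measure lborel {0..2 * pi}) (restrict_space borel (sphere 0 1)) cis"

text \<open>A point of the \<open>N\<close>-torus is a function in \<open>{..<N} \<rightarrow>\<^sub>E sphere 0 1\<close>;
  the coordinates are numbered from \<open>0\<close> to \<open>N - 1\<close>.\<close>

definition torus :: "nat \<Rightarrow> (nat \<Rightarrow> complex) measure" where
  "torus N = (\<Pi>\<^sub>M j\<in>{..<N}. circle_haar)"

lemma space_circle_haar [simp]: "space circle_haar = sphere 0 1"
  by (simp add: circle_haar_def space_restrict_space)

lemma space_torus: "space (torus N) = {..<N} \<rightarrow>\<^sub>E sphere 0 1"
  by (simp add: torus_def space_PiM)

lemma prob_space_circle_haar: "prob_space circle_haar"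
proof -
  have "prob_space (uniform_measure lborel {0..2 * pi})"
    by (rule prob_space_uniform_measure) auto
  moreover have "cis \<in> borel_measurable borel"
    by (intro borel_measurable_continuous_onI continuous_intros)
  then have "cis \<in> borel_measurable (uniform_measure lborel {0..2 * pi})"
    by (simp add: measurable_def)
  then have "cis \<in> uniform_measure lborel {0..2 * pi} \<rightarrow>\<^sub>M restrict_space borel (sphere 0 1)"
    by (rule measurable_restrict_space2[rotated]) simp
  ultimately show ?thesis
    unfolding circle_haar_def by (rule prob_space.prob_space_distr)
qed

lemma prob_space_torus: "prob_space (torus N)"
  unfolding torus_def by (rule prob_space_PiM) (rule prob_space_circle_haar)

text \<open>Elements of the function spaces below are represented by functions rather than by classes
  modulo almost everywhere equality. The Fourier coefficients, the inner product and
  multiplication all respect that relation. Only the values \<open>\<alpha> j\<close> with \<open>j < N\<close> of a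
  multi-index matter.\<close>

definition monomial :: "nat \<Rightarrow> (nat \<Rightarrow> int) \<Rightarrow> (nat \<Rightarrow> complex) \<Rightarrow> complex" where
  "monomial N \<alpha> \<zeta> = (\<Prod>j<N. \<zeta> j powi \<alpha> j)"

definition L2 :: "nat \<Rightarrow> ((nat \<Rightarrow> complex) \<Rightarrow> complex) set" where
  "L2 N = {f \<in> borel_measurable (torus N). integrable (torus N) (\<lambda>\<zeta>. (cmod (f \<zeta>))\<^sup>2)}"

definition L2_inner ::
  "nat \<Rightarrow> ((nat \<Rightarrow> complex) \<Rightarrow> complex) \<Rightarrow> ((nat \<Rightarrow> complex) \<Rightarrow> complex) \<Rightarrow> complex" where
  "L2_inner N f g = (LINT \<zeta>|torus N. f \<zeta> * cnj (g \<zeta>))"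

definition fourier_coeff ::
  "nat \<Rightarrow> ((nat \<Rightarrow> complex) \<Rightarrow> complex) \<Rightarrow> (nat \<Rightarrow> int) \<Rightarrow> complex" where
  "fourier_coeff N f \<alpha> = (LINT \<zeta>|torus N. f \<zeta> * monomial N (\<lambda>j. - \<alpha> j) \<zeta>)"

definition H2 :: "nat \<Rightarrow> ((nat \<Rightarrow> complex) \<Rightarrow> complex) set" where
  "H2 N = {f \<in> L2 N. \<forall>\<alpha>. \<not> (\<forall>j<N. 0 \<le> \<alpha> j) \<longrightarrow> fourier_coeff N f \<alpha> = 0}"

definition Linfty :: "nat \<Rightarrow> ((nat \<Rightarrow> complex) \<Rightarrow> complex) set" where
  "Linfty N = {f \<in> borel_measurable (torus N). \<exists>C. AE \<zeta> in torus N. cmod (f \<zeta>) \<le> C}"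

definition Hinfty :: "nat \<Rightarrow> ((nat \<Rightarrow> complex) \<Rightarrow> complex) set" where
  "Hinfty N = Linfty N \<inter> H2 N"

definition mult_op :: "('a \<Rightarrow> complex) \<Rightarrow> ('a \<Rightarrow> complex) \<Rightarrow> 'a \<Rightarrow> complex" where
  "mult_op \<phi> f = (\<lambda>\<zeta>. \<phi> \<zeta> * f \<zeta>)"

text \<open>The Hilbert space is given by a set \<open>H\<close> of (representatives of) vectors and its inner
  product \<open>ip\<close>, linear in the first argument; \<open>Re (ip y y)\<close> is the squared norm of \<open>y\<close>.
  Summability is part of the upper bound, because \<open>infsum\<close> of a divergent family is \<open>0\<close>.\<close>

definition is_frame ::
  "'h set \<Rightarrow> ('h \<Rightarrow> 'h \<Rightarrow> complex) \<Rightarrow> 'j set \<Rightarrow> ('j \<Rightarrow> 'h) \<Rightarrow> bool" where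
  "is_frame H ip \<Omega> x \<longleftrightarrow>
     countable \<Omega> \<and> (\<forall>j\<in>\<Omega>. x j \<in> H) \<and>
     (\<exists>A>0. \<exists>B>0. \<forall>y\<in>H.
        (\<lambda>j. (cmod (ip y (x j)))\<^sup>2) summable_on \<Omega> \<and>
        A * Re (ip y y) \<le> (\<Sum>\<^sub>\<infinity>j\<in>\<Omega>. (cmod (ip y (x j)))\<^sup>2) \<and>
        (\<Sum>\<^sub>\<infinity>j\<in>\<Omega>. (cmod (ip y (x j)))\<^sup>2) \<le> B * Re (ip y y))"

end

theory Submission
  imports Defs
begin

text \<open>
  Write \<open>T\<close> for multiplication by \<open>\<phi>\<close>, and suppose that the orbits of \<open>m\<close> vectors \<open>f i\<close> under \<open>T\<close>
  form a frame. If \<open>y\<close> is an eigenvector of the adjoint of \<open>T\<close> with eigenvalue \<open>cnj \<lambda>\<close>, then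
  \<open>\<langle>y, T^n f i\<rangle> = (cnj \<lambda>)^n \<langle>y, f i\<rangle>\<close>. So if \<open>y\<close> is in addition orthogonal to all \<open>f i\<close>, then it is
  orthogonal to the whole family, and the lower frame bound forces \<open>y = 0\<close>. Hence every eigenspace
  of the adjoint has dimension at most \<open>m\<close>. In two or more variables this fails, because an
  analytic function has no isolated zeros there, so that the quotient of the analytic functions by the
  multiples of \<open>\<phi> - \<phi> 0\<close> is infinite-dimensional.

  The last fact is used here in the form of a dimension count for jets at the origin. Let \<open>Y\<^sub>d\<close> be the
  span of the monomials \<open>\<zeta>\<^sub>0^i \<zeta>\<^sub>1^j\<close> with \<open>i + j < d\<close>; its dimension is \<open>d * (d + 1) / 2\<close>. Its elements
  are the functionals that see only the Taylor coefficients of these orders. The adjoint of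
  multiplication by \<open>\<phi> - \<lambda>\<close>, where \<open>\<lambda>\<close> is the constant coefficient of \<open>\<phi>\<close>, lowers the degree
  and therefore maps \<open>Y\<^sub>d\<close> for \<open>d = m + 1\<close> into \<open>Y\<^sub>d\<close> for \<open>d = m\<close>, so its kernel there has dimension
  at least \<open>m + 1\<close>. That leaves a nonzero \<open>y\<close> in this kernel that is orthogonal to the \<open>m\<close>
  generators. Concretely, \<open>y\<close> is a nontrivial solution of a homogeneous linear system with one
  equation fewer than unknowns (\<open>homogeneous_system_nontrivial\<close>), and \<open>poly2_joint_eigenvector\<close>
  shows that the equations make it an eigenvector on \<open>H\<^sup>2\<close>.

  The analytic input is that the low Fourier coefficients of a product of two functions in \<open>H\<^sup>2\<close> are
  the finite convolutions that Taylor coefficients obey (\<open>fourier_coeff_mult\<close>). This rests on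
  the density of analytic polynomials in \<open>H\<^sup>2\<close>, which follows by orthogonal projection from the density
  of trigonometric polynomials in \<open>L\<^sup>2\<close> of the torus. The latter is proved from the
  Stone--Weierstrass theorem, by way of indicators of closed boxes and a Dynkin argument.
\<close>

section \<open>Monomials on the torus\<close>

lemma sets_circle_haar: "sets circle_haar = sets (restrict_space borel (sphere 0 1))"
  by (simp add: circle_haar_def)

lemma measurable_torus_coord [measurable]:
  assumes "j < N" shows "(\<lambda>\<zeta>. \<zeta> j) \<in> borel_measurable (torus N)"
proof -
  have "(\<lambda>\<zeta>. \<zeta> j) \<in> torus N \<rightarrow>\<^sub>M circle_haar"
    unfolding torus_def using assms by (intro measurable_component_singleton) simp
  moreover have "(\<lambda>z. z) \<in> circle_haar \<rightarrow>\<^sub>M borel"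
    unfolding measurable_cong_sets[OF sets_circle_haar refl]
    by (intro measurable_restrict_space1) simp
  ultimately show ?thesis by (rule measurable_compose)
qed

lemma norm_torus_coord: "\<zeta> \<in> space (torus N) \<Longrightarrow> j < N \<Longrightarrow> cmod (\<zeta> j) = 1"
  by (auto simp: space_torus PiE_iff)

lemma measurable_powi [measurable]:
  "f \<in> borel_measurable M \<Longrightarrow> (\<lambda>x. (f x :: complex) powi k) \<in> borel_measurable M"
  by (cases "k \<ge> 0") (simp_all add: power_int_def)

lemma measurable_monomial [measurable]: "monomial N \<alpha> \<in> borel_measurable (torus N)"
  unfolding monomial_def by (intro borel_measurable_prod measurable_powi measurable_torus_coord) simp

lemma norm_monomial: "\<zeta> \<in> space (torus N) \<Longrightarrow> cmod (monomial N \<alpha> \<zeta>) = 1"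
  unfolding monomial_def
  by (auto simp: norm_power_int norm_torus_coord simp flip: prod_norm intro!: prod.neutral)

lemma monomial_zero: "monomial N (\<lambda>_. 0) = (\<lambda>_. 1)"
  by (simp add: monomial_def fun_eq_iff)

lemma monomial_mult:
  assumes "\<zeta> \<in> space (torus N)"
  shows "monomial N \<alpha> \<zeta> * monomial N \<beta> \<zeta> = monomial N (\<lambda>j. \<alpha> j + \<beta> j) \<zeta>"
proof -
  have "\<zeta> j \<noteq> 0" if "j < N" for j
    using norm_torus_coord[OF assms that] by auto
  then show ?thesis
    unfolding monomial_def prod.distrib[symmetric]
    by (intro prod.cong) (auto simp: power_int_add)
qed

lemma monomial_cnj:
  assumes "\<zeta> \<in> space (torus N)"
  shows "cnj (monomial N \<alpha> \<zeta>) = monomial N (\<lambda>j. - \<alpha> j) \<zeta>"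
proof -
  have "cnj (\<zeta> j powi \<alpha> j) = \<zeta> j powi (- \<alpha> j)" if "j < N" for j
  proof -
    have *: "cnj (\<zeta> j) = inverse (\<zeta> j)"
      using norm_torus_coord[OF assms that]
      by (intro inverse_unique[symmetric]) (simp add: complex_norm_square[symmetric])
    show ?thesis
      by (cases "0 \<le> \<alpha> j") (simp_all add: * power_int_def power_inverse)
  qed
  then show ?thesis
    unfolding monomial_def by (simp add: cnj_prod)
qed

lemma monomial_cong: "(\<And>j. j < N \<Longrightarrow> \<alpha> j = \<beta> j) \<Longrightarrow> monomial N \<alpha> = monomial N \<beta>"
  unfolding monomial_def by (intro ext prod.cong) auto

lemma integral_circle_powi:
  "(LINT z|circle_haar. z powi k) = (if k = 0 then 1 else 0)"
  and integrable_circle_powi: "integrable circle_haar (\<lambda>z. z powi k)"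
proof -
  interpret prob_space circle_haar by (rule prob_space_circle_haar)
  have id: "(\<lambda>z. z) \<in> circle_haar \<rightarrow>\<^sub>M borel"
    unfolding measurable_cong_sets[OF sets_circle_haar refl]
    by (intro measurable_restrict_space1) simp
  have m: "(\<lambda>z. z powi k) \<in> borel_measurable circle_haar"
    by (rule measurable_powi[OF id])
  show "integrable circle_haar (\<lambda>z. z powi k)"
    by (rule integrable_const_bound[where B=1]) (use m in \<open>auto simp: norm_power_int\<close>)
  show "(LINT z|circle_haar. z powi k) = (if k = 0 then 1 else 0)"
  proof (cases "k = 0")
    case True
    then show ?thesis using prob_space by simp
  next
    case False
    have cis: "cis \<in> uniform_measure lborel {0..2 * pi} \<rightarrow>\<^sub>M restrict_space borel (sphere 0 1)"
    proof (rule measurable_restrict_space2)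
      show "cis \<in> borel_measurable (uniform_measure lborel {0..2 * pi})"
        unfolding measurable_cong_sets[OF sets_uniform_measure refl]
        by (simp, intro borel_measurable_continuous_onI continuous_intros)
    qed simp
    have m': "(\<lambda>z::complex. z powi k) \<in> borel_measurable (restrict_space borel (sphere 0 1))"
      using m unfolding measurable_cong_sets[OF sets_circle_haar refl] .
    have "(LINT z|circle_haar. z powi k) = (LINT x|uniform_measure lborel {0..2 * pi}. cis x powi k)"
      unfolding circle_haar_def by (rule integral_distr[OF cis m'])
    also have "\<dots> = (LINT x|uniform_measure lborel {0..2 * pi}. cis (of_int k * x))"
      by (simp add: cis_power_int)
    also have "\<dots> = (LINT x|lborel. (indicator {0..2 * pi} x / (2 * pi)) *\<^sub>R cis (of_int k * x))"
    proof -
      have "uniform_measure lborel {0..2 * pi}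
          = density lborel (\<lambda>x. ennreal (indicator {0..2 * pi} x / (2 * pi)))"
        unfolding uniform_measure_def
        by (intro density_cong) (auto simp: divide_ennreal indicator_def simp flip: ennreal_1)
      moreover have "(\<lambda>x. cis (of_int k * x)) \<in> borel_measurable lborel"
        by (simp, intro borel_measurable_continuous_onI continuous_intros)
      ultimately show ?thesis
        by (simp add: integral_density)
    qed
    also have "\<dots> = (LINT x|lborel. indicator {0..2 * pi} x *\<^sub>R (cis (of_int k * x) / (2 * pi)))"
      by (intro Bochner_Integration.integral_cong) (auto simp: scaleR_conv_of_real)
    also have "\<dots> = cis (of_int k * (2 * pi)) / (2 * pi * \<i> * of_int k)
        - cis (of_int k * 0) / (2 * pi * \<i> * of_int k)"
    proof (rule integral_FTC_Icc)
      fix x :: real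
      have "((\<lambda>x. exp (\<i> * (of_int k * of_real x)) / (2 * pi * \<i> * of_int k)) has_vector_derivative
          exp (\<i> * (of_int k * of_real x)) / (2 * pi)) (at x within {0..2 * pi})"
        by (rule has_vector_derivative_real_field)
           (use False in \<open>auto intro!: derivative_eq_intros simp: field_simps\<close>)
      then show "((\<lambda>x. cis (of_int k * x) / (2 * pi * \<i> * of_int k)) has_vector_derivative
          cis (of_int k * x) / (2 * pi)) (at x within {0..2 * pi})"
        by (simp add: cis_conv_exp)
    qed (auto intro!: continuous_intros)
    also have "cis (of_int k * (2 * pi)) = 1"
      by (metis Ints_of_int cis_multiple_2pi mult.commute)
    finally show ?thesis using False by simp
  qed
qed

lemma integral_monomial:
  "(LINT \<zeta>|torus N. monomial N \<alpha> \<zeta>) = (if \<forall>j<N. \<alpha> j = 0 then 1 else 0)"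
proof -
  interpret product_sigma_finite "\<lambda>_::nat. circle_haar"
    by (intro product_sigma_finite.intro prob_space_imp_sigma_finite prob_space_circle_haar)
  have "(LINT \<zeta>|torus N. monomial N \<alpha> \<zeta>) = (\<Prod>j<N. LINT z|circle_haar. z powi \<alpha> j)"
    unfolding torus_def monomial_def
    by (rule product_integral_prod[where f = "\<lambda>j z. z powi \<alpha> j"]) (auto intro: integrable_circle_powi)
  then show ?thesis
    by (auto simp: integral_circle_powi)
qed

section \<open>Square-integrable functions\<close>

lemma cmod_add_square_le: "(cmod (x + y))\<^sup>2 \<le> 2 * (cmod x)\<^sup>2 + 2 * (cmod y)\<^sup>2"
proof -
  have "(cmod (x + y))\<^sup>2 \<le> (cmod x + cmod y)\<^sup>2"
    by (intro power_mono norm_triangle_ineq) simp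
  also have "\<dots> \<le> 2 * (cmod x)\<^sup>2 + 2 * (cmod y)\<^sup>2"
    using zero_le_power2[of "cmod x - cmod y"] unfolding power2_diff power2_sum by linarith
  finally show ?thesis .
qed

lemma L2_measurable: "f \<in> L2 N \<Longrightarrow> f \<in> borel_measurable (torus N)"
  by (simp add: L2_def)

lemma L2_integrable_square: "f \<in> L2 N \<Longrightarrow> integrable (torus N) (\<lambda>\<zeta>. (cmod (f \<zeta>))\<^sup>2)"
  by (simp add: L2_def)

lemma L2_I_dominated:
  assumes "f \<in> borel_measurable (torus N)" "integrable (torus N) w"
    and "\<And>\<zeta>. \<zeta> \<in> space (torus N) \<Longrightarrow> (cmod (f \<zeta>))\<^sup>2 \<le> w \<zeta>"
  shows "f \<in> L2 N"
  unfolding L2_def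
proof (intro CollectI conjI)
  show "integrable (torus N) (\<lambda>\<zeta>. (cmod (f \<zeta>))\<^sup>2)"
    by (rule Bochner_Integration.integrable_bound[OF assms(2)])
       (use assms in \<open>auto intro!: AE_I2 order_trans[OF _ abs_ge_self]\<close>)
qed fact

lemma L2_add: assumes "f \<in> L2 N" "g \<in> L2 N" shows "(\<lambda>\<zeta>. f \<zeta> + g \<zeta>) \<in> L2 N"
  by (rule L2_I_dominated[where w = "\<lambda>\<zeta>. 2 * (cmod (f \<zeta>))\<^sup>2 + 2 * (cmod (g \<zeta>))\<^sup>2"])
     (use assms in \<open>auto intro: cmod_add_square_le simp: L2_def\<close>)

lemma L2_mult_bounded:
  assumes "f \<in> L2 N" "h \<in> borel_measurable (torus N)"
    and "\<And>\<zeta>. \<zeta> \<in> space (torus N) \<Longrightarrow> cmod (h \<zeta>) \<le> C"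
  shows "(\<lambda>\<zeta>. h \<zeta> * f \<zeta>) \<in> L2 N"
proof (rule L2_I_dominated[where w = "\<lambda>\<zeta>. C\<^sup>2 * (cmod (f \<zeta>))\<^sup>2"])
  show "(cmod (h \<zeta> * f \<zeta>))\<^sup>2 \<le> C\<^sup>2 * (cmod (f \<zeta>))\<^sup>2" if "\<zeta> \<in> space (torus N)" for \<zeta>
    unfolding norm_mult power_mult_distrib
    by (intro mult_right_mono power_mono assms that) auto
qed (use assms in \<open>auto simp: L2_def\<close>)

lemma L2_scale: "f \<in> L2 N \<Longrightarrow> (\<lambda>\<zeta>. c * f \<zeta>) \<in> L2 N"
  by (rule L2_mult_bounded[where C = "cmod c"]) auto

lemma L2_diff: "f \<in> L2 N \<Longrightarrow> g \<in> L2 N \<Longrightarrow> (\<lambda>\<zeta>. f \<zeta> - g \<zeta>) \<in> L2 N"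
  using L2_add[of f N "\<lambda>\<zeta>. (-1) * g \<zeta>"] L2_scale[of g N "-1"] by simp

lemma L2_bounded:
  assumes "h \<in> borel_measurable (torus N)"
    and "\<And>\<zeta>. \<zeta> \<in> space (torus N) \<Longrightarrow> cmod (h \<zeta>) \<le> C"
  shows "h \<in> L2 N"
proof -
  interpret prob_space "torus N" by (rule prob_space_torus)
  have "(\<lambda>_. 1) \<in> L2 N" by (simp add: L2_def)
  from L2_mult_bounded[OF this assms] show ?thesis by simp
qed

lemma L2_cong:
  assumes "f \<in> L2 N" "\<And>\<zeta>. \<zeta> \<in> space (torus N) \<Longrightarrow> g \<zeta> = f \<zeta>"
  shows "g \<in> L2 N"
  using assms by (simp add: L2_def cong: measurable_cong Bochner_Integration.integrable_cong)

lemma L2_sum: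
  assumes "\<And>i. i \<in> I \<Longrightarrow> f i \<in> L2 N"
  shows "(\<lambda>\<zeta>. \<Sum>i\<in>I. f i \<zeta>) \<in> L2 N"
  using assms
  by (induction I rule: infinite_finite_induct)
     (auto intro: L2_add L2_bounded[of "\<lambda>_. 0" N 0])

lemma integrable_L2_mult:
  assumes "f \<in> L2 N" "g \<in> L2 N"
  shows "integrable (torus N) (\<lambda>\<zeta>. f \<zeta> * g \<zeta>)"
proof (rule Bochner_Integration.integrable_bound)
  show "integrable (torus N) (\<lambda>\<zeta>. (cmod (f \<zeta>))\<^sup>2 + (cmod (g \<zeta>))\<^sup>2)"
    using assms by (simp add: L2_def)
  have "cmod x * cmod y \<le> (cmod x)\<^sup>2 + (cmod y)\<^sup>2" for x y
    using zero_le_power2[of "cmod x - cmod y"] zero_le_power2[of "cmod x"] zero_le_power2[of "cmod y"]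
    unfolding power2_diff by linarith
  then show "AE \<zeta> in torus N. cmod (f \<zeta> * g \<zeta>) \<le> norm ((cmod (f \<zeta>))\<^sup>2 + (cmod (g \<zeta>))\<^sup>2)"
    by (simp add: norm_mult)
qed (use assms in \<open>auto simp: L2_def\<close>)

lemma L2_cnj: "f \<in> L2 N \<Longrightarrow> (\<lambda>\<zeta>. cnj (f \<zeta>)) \<in> L2 N"
  unfolding L2_def
  by (auto intro: measurable_compose[OF _ borel_measurable_continuous_onI] continuous_intros)

lemma monomial_L2: "monomial N \<alpha> \<in> L2 N"
  by (rule L2_bounded[OF measurable_monomial, where C = 1]) (simp add: norm_monomial)

section \<open>Trigonometric polynomials\<close>

text \<open>Trigonometric polynomials with frequencies in \<open>\<Lambda>\<close>. The rule \<open>cong\<close> identifies functions that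
  agree on the torus; without it, closure under products and conjugation would fail, since
  \<open>z powi a * z powi b = z powi (a + b)\<close> and \<open>cnj z = inverse z\<close> need \<open>z\<close> to be on the circle.\<close>

inductive trig_poly ::
  "nat \<Rightarrow> (nat \<Rightarrow> int) set \<Rightarrow> ((nat \<Rightarrow> complex) \<Rightarrow> complex) \<Rightarrow> bool" for N \<Lambda> where
  zero: "trig_poly N \<Lambda> (\<lambda>_. 0)"
| add_term: "\<alpha> \<in> \<Lambda> \<Longrightarrow> trig_poly N \<Lambda> p \<Longrightarrow> trig_poly N \<Lambda> (\<lambda>\<zeta>. c * monomial N \<alpha> \<zeta> + p \<zeta>)"
| cong: "trig_poly N \<Lambda> p \<Longrightarrow> (\<And>\<zeta>. \<zeta> \<in> space (torus N) \<Longrightarrow> q \<zeta> = p \<zeta>) \<Longrightarrow> trig_poly N \<Lambda> q"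

lemma trig_poly_term: "\<alpha> \<in> \<Lambda> \<Longrightarrow> trig_poly N \<Lambda> (\<lambda>\<zeta>. c * monomial N \<alpha> \<zeta>)"
  using trig_poly.add_term[OF _ trig_poly.zero] by simp

lemma trig_poly_const: "trig_poly N UNIV (\<lambda>_. c)"
  using trig_poly_term[of "\<lambda>_. 0" UNIV N c] by (simp add: monomial_zero)

lemma trig_poly_add:
  assumes "trig_poly N \<Lambda> p" "trig_poly N \<Lambda> q"
  shows "trig_poly N \<Lambda> (\<lambda>\<zeta>. p \<zeta> + q \<zeta>)"
  using assms(1)
proof induction
  case zero
  then show ?case using assms(2) by simp
next
  case (add_term \<alpha> p c)
  then show ?case
    by (auto simp: add.assoc intro: trig_poly.add_term)
next
  case (cong p r)
  then show ?case by (auto intro: trig_poly.cong)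
qed

lemma trig_poly_mult_term:
  assumes "trig_poly N UNIV q"
  shows "trig_poly N UNIV (\<lambda>\<zeta>. c * monomial N \<alpha> \<zeta> * q \<zeta>)"
  using assms
proof induction
  case zero
  then show ?case by (simp add: trig_poly.zero)
next
  case (add_term \<beta> q d)
  have "trig_poly N UNIV (\<lambda>\<zeta>. (c * d) * monomial N (\<lambda>j. \<alpha> j + \<beta> j) \<zeta> + c * monomial N \<alpha> \<zeta> * q \<zeta>)"
    by (intro trig_poly.add_term add_term.IH) simp
  then show ?case
    by (rule trig_poly.cong) (simp add: monomial_mult[symmetric] algebra_simps)
next
  case (cong p r)
  show ?case by (rule trig_poly.cong[OF cong.IH]) (simp add: cong.hyps)
qed

lemma trig_poly_mult:
  assumes "trig_poly N UNIV p" "trig_poly N UNIV q"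
  shows "trig_poly N UNIV (\<lambda>\<zeta>. p \<zeta> * q \<zeta>)"
  using assms(1)
proof induction
  case zero
  then show ?case by (simp add: trig_poly.zero)
next
  case (add_term \<alpha> p c)
  then show ?case
    using trig_poly_add[OF trig_poly_mult_term[OF assms(2)] add_term.IH]
    by (simp add: algebra_simps)
next
  case (cong p r)
  show ?case by (rule trig_poly.cong[OF cong.IH]) (simp add: cong.hyps)
qed

lemma trig_poly_L2: "trig_poly N \<Lambda> p \<Longrightarrow> p \<in> L2 N"
  by (induction rule: trig_poly.induct)
     (auto intro: L2_bounded[of "\<lambda>_. 0" N 0] L2_add[OF L2_scale[OF monomial_L2]] L2_cong)

text \<open>The splitting into analytic and remaining frequencies, by which an approximation in \<open>L\<^sup>2\<close> is turned
  into an approximation by analytic polynomials.\<close>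

lemma trig_poly_split:
  assumes "trig_poly N UNIV p"
  shows "\<exists>q r. trig_poly N \<Lambda> q \<and> trig_poly N (- \<Lambda>) r \<and>
    (\<forall>\<zeta>\<in>space (torus N). p \<zeta> = q \<zeta> + r \<zeta>)"
  using assms
proof induction
  case zero
  show ?case by (intro exI[of _ "\<lambda>_. 0"]) (simp add: trig_poly.zero)
next
  case (add_term \<alpha> p c)
  then obtain q r where qr: "trig_poly N \<Lambda> q" "trig_poly N (- \<Lambda>) r"
    "\<forall>\<zeta>\<in>space (torus N). p \<zeta> = q \<zeta> + r \<zeta>" by blast
  show ?case
  proof (cases "\<alpha> \<in> \<Lambda>")
    case True
    then show ?thesis
      by (intro exI[of _ "\<lambda>\<zeta>. c * monomial N \<alpha> \<zeta> + q \<zeta>"] exI[of _ r])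
         (use qr in \<open>auto intro: trig_poly.add_term\<close>)
  next
    case False
    then show ?thesis
      by (intro exI[of _ q] exI[of _ "\<lambda>\<zeta>. c * monomial N \<alpha> \<zeta> + r \<zeta>"])
         (use qr in \<open>auto intro: trig_poly.add_term\<close>)
  qed
next
  case (cong p q)
  then show ?case by simp
qed

lemma integral_trig_poly_mult_eq_0:
  assumes "trig_poly N \<Lambda> p" "u \<in> L2 N"
    and "\<And>\<alpha>. \<alpha> \<in> \<Lambda> \<Longrightarrow> (LINT \<zeta>|torus N. monomial N \<alpha> \<zeta> * u \<zeta>) = 0"
  shows "(LINT \<zeta>|torus N. p \<zeta> * u \<zeta>) = 0"
  using assms(1)
proof induction
  case (add_term \<alpha> p c)
  have "(LINT \<zeta>|torus N. (c * monomial N \<alpha> \<zeta> + p \<zeta>) * u \<zeta>)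
      = (LINT \<zeta>|torus N. c * (monomial N \<alpha> \<zeta> * u \<zeta>) + p \<zeta> * u \<zeta>)"
    by (simp add: algebra_simps)
  also have "\<dots> = 0"
    using add_term integrable_L2_mult[OF monomial_L2 assms(2)]
      integrable_L2_mult[OF trig_poly_L2[OF add_term.hyps(2)] assms(2)] assms(3)
    by simp
  finally show ?case .
next
  case (cong p q)
  then show ?case by (simp cong: Bochner_Integration.integral_cong)
qed simp

lemma trig_poly_cnj:
  assumes "trig_poly N \<Lambda> p" "\<And>\<alpha>. \<alpha> \<in> \<Lambda> \<Longrightarrow> (\<lambda>j. - \<alpha> j) \<in> \<Lambda>'"
  shows "trig_poly N \<Lambda>' (\<lambda>\<zeta>. cnj (p \<zeta>))"
  using assms(1)
proof induction
  case (add_term \<alpha> p c)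
  show ?case
    by (rule trig_poly.cong[OF trig_poly.add_term[OF assms(2)[OF add_term.hyps(1)] add_term.IH, of "cnj c"]])
       (simp add: monomial_cnj)
next
  case (cong p q)
  show ?case by (rule trig_poly.cong[OF cong.IH]) (simp add: cong.hyps)
qed (simp add: trig_poly.zero)

section \<open>The mean-square closure of the trigonometric polynomials\<close>

text \<open>Membership in the \<open>L\<^sup>2\<close>-closure of the trigonometric polynomials. The next section shows that
  it holds for all of \<open>L\<^sup>2\<close>; until then the predicate carries the closure properties that the
  successive classes of functions need.\<close>

definition approximable :: "nat \<Rightarrow> ((nat \<Rightarrow> complex) \<Rightarrow> complex) \<Rightarrow> bool" where
  "approximable N f \<longleftrightarrow> f \<in> L2 N \<and>
    (\<forall>\<epsilon>>0. \<exists>p. trig_poly N UNIV p \<and> (LINT \<zeta>|torus N. (cmod (f \<zeta> - p \<zeta>))\<^sup>2) < \<epsilon>)"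

lemma approximable_L2: "approximable N f \<Longrightarrow> f \<in> L2 N"
  by (simp add: approximable_def)

lemma integral_square_add_le:
  assumes "f \<in> L2 N" "g \<in> L2 N"
  shows "(LINT \<zeta>|torus N. (cmod (f \<zeta> + g \<zeta>))\<^sup>2)
    \<le> 2 * (LINT \<zeta>|torus N. (cmod (f \<zeta>))\<^sup>2) + 2 * (LINT \<zeta>|torus N. (cmod (g \<zeta>))\<^sup>2)"
proof -
  have "(LINT \<zeta>|torus N. (cmod (f \<zeta> + g \<zeta>))\<^sup>2)
    \<le> (LINT \<zeta>|torus N. 2 * (cmod (f \<zeta>))\<^sup>2 + 2 * (cmod (g \<zeta>))\<^sup>2)"
    by (intro integral_mono)
       (use assms L2_add[OF assms] in \<open>auto simp: L2_integrable_square intro: cmod_add_square_le\<close>)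
  then show ?thesis
    using assms by (simp add: L2_integrable_square)
qed

lemma approximable_closed:
  assumes f: "f \<in> L2 N"
    and g: "\<And>\<epsilon>. \<epsilon> > 0 \<Longrightarrow> \<exists>g. approximable N g \<and> (LINT \<zeta>|torus N. (cmod (f \<zeta> - g \<zeta>))\<^sup>2) < \<epsilon>"
  shows "approximable N f"
  unfolding approximable_def
proof (intro conjI allI impI f)
  fix \<epsilon> :: real assume "\<epsilon> > 0"
  then obtain g where g: "approximable N g" "(LINT \<zeta>|torus N. (cmod (f \<zeta> - g \<zeta>))\<^sup>2) < \<epsilon> / 4"
    using g[of "\<epsilon> / 4"] by auto
  obtain p where p: "trig_poly N UNIV p" "(LINT \<zeta>|torus N. (cmod (g \<zeta> - p \<zeta>))\<^sup>2) < \<epsilon> / 4"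
    using g(1) \<open>\<epsilon> > 0\<close> unfolding approximable_def by (meson zero_less_divide_iff zero_less_numeral)
  have "(LINT \<zeta>|torus N. (cmod (f \<zeta> - p \<zeta>))\<^sup>2) < \<epsilon>"
    using integral_square_add_le[OF L2_diff[OF f approximable_L2[OF g(1)]]
        L2_diff[OF approximable_L2[OF g(1)] trig_poly_L2[OF p(1)]]] g(2) p(2)
    by simp
  with p(1) show "\<exists>p. trig_poly N UNIV p \<and> (LINT \<zeta>|torus N. (cmod (f \<zeta> - p \<zeta>))\<^sup>2) < \<epsilon>"
    by blast
qed

lemma approximable_trig_poly: "trig_poly N UNIV p \<Longrightarrow> approximable N p"
  unfolding approximable_def by (intro conjI allI impI exI[of _ p] trig_poly_L2) auto

lemma approximable_add:
  assumes f: "approximable N f" and g: "approximable N g"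
  shows "approximable N (\<lambda>\<zeta>. f \<zeta> + g \<zeta>)"
  unfolding approximable_def
proof (intro conjI allI impI)
  show "(\<lambda>\<zeta>. f \<zeta> + g \<zeta>) \<in> L2 N"
    by (intro L2_add approximable_L2 assms)
  fix \<epsilon> :: real assume "\<epsilon> > 0"
  then have "\<epsilon> / 4 > 0" by simp
  then obtain p q where
    p: "trig_poly N UNIV p" "(LINT \<zeta>|torus N. (cmod (f \<zeta> - p \<zeta>))\<^sup>2) < \<epsilon> / 4" and
    q: "trig_poly N UNIV q" "(LINT \<zeta>|torus N. (cmod (g \<zeta> - q \<zeta>))\<^sup>2) < \<epsilon> / 4"
    using assms unfolding approximable_def by meson
  have "(LINT \<zeta>|torus N. (cmod (f \<zeta> + g \<zeta> - (p \<zeta> + q \<zeta>)))\<^sup>2) < \<epsilon>"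
    using integral_square_add_le[OF L2_diff[OF approximable_L2[OF f] trig_poly_L2[OF p(1)]]
        L2_diff[OF approximable_L2[OF g] trig_poly_L2[OF q(1)]]] p(2) q(2)
    by (simp add: algebra_simps)
  then show "\<exists>p. trig_poly N UNIV p \<and> (LINT \<zeta>|torus N. (cmod (f \<zeta> + g \<zeta> - p \<zeta>))\<^sup>2) < \<epsilon>"
    using trig_poly_add[OF p(1) q(1)] by blast
qed

lemma approximable_scale:
  assumes f: "approximable N f"
  shows "approximable N (\<lambda>\<zeta>. c * f \<zeta>)"
proof (rule approximable_closed)
  show "(\<lambda>\<zeta>. c * f \<zeta>) \<in> L2 N"
    by (intro L2_scale approximable_L2 f)
  fix \<epsilon> :: real assume "\<epsilon> > 0"
  then have "\<epsilon> / (1 + (cmod c)\<^sup>2) > 0" by (simp add: add_pos_nonneg)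
  then obtain p where
    p: "trig_poly N UNIV p" "(LINT \<zeta>|torus N. (cmod (f \<zeta> - p \<zeta>))\<^sup>2) < \<epsilon> / (1 + (cmod c)\<^sup>2)"
    using assms unfolding approximable_def by meson
  have "(LINT \<zeta>|torus N. (cmod (c * f \<zeta> - c * p \<zeta>))\<^sup>2)
      = (LINT \<zeta>|torus N. (cmod c)\<^sup>2 * (cmod (f \<zeta> - p \<zeta>))\<^sup>2)"
    by (simp add: norm_mult power_mult_distrib flip: right_diff_distrib)
  also have "\<dots> = (cmod c)\<^sup>2 * (LINT \<zeta>|torus N. (cmod (f \<zeta> - p \<zeta>))\<^sup>2)"
    by simp
  also have "\<dots> \<le> (1 + (cmod c)\<^sup>2) * (LINT \<zeta>|torus N. (cmod (f \<zeta> - p \<zeta>))\<^sup>2)"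
    by (intro mult_right_mono) auto
  also have "\<dots> < \<epsilon>"
    using p(2) by (simp add: pos_less_divide_eq add_pos_nonneg mult.commute)
  finally have "(LINT \<zeta>|torus N. (cmod (c * f \<zeta> - c * p \<zeta>))\<^sup>2) < \<epsilon>" .
  moreover have "trig_poly N UNIV (\<lambda>\<zeta>. c * p \<zeta>)"
    using trig_poly_mult[OF trig_poly_const p(1)] .
  ultimately show "\<exists>g. approximable N g \<and> (LINT \<zeta>|torus N. (cmod (c * f \<zeta> - g \<zeta>))\<^sup>2) < \<epsilon>"
    using approximable_trig_poly by blast
qed

lemma approximable_cong:
  assumes "approximable N f" "\<And>\<zeta>. \<zeta> \<in> space (torus N) \<Longrightarrow> g \<zeta> = f \<zeta>"
  shows "approximable N g"
  using assms L2_cong[of f N g]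
  by (simp add: approximable_def cong: Bochner_Integration.integral_cong)

lemma approximable_sum:
  assumes "\<And>i. i \<in> I \<Longrightarrow> approximable N (f i)"
  shows "approximable N (\<lambda>\<zeta>. \<Sum>i\<in>I. f i \<zeta>)"
  using assms
proof (induction I rule: infinite_finite_induct)
  case (insert i I)
  then show ?case
    using approximable_add[of N "f i" "\<lambda>\<zeta>. \<Sum>i\<in>I. f i \<zeta>"] by simp
qed (simp_all add: approximable_trig_poly trig_poly.zero)

text \<open>The squared errors are at most \<open>4 w\<close> and tend to \<open>0\<close> pointwise, so dominated convergence applies
  to them.\<close>

lemma approximable_dominated_limit:
  assumes f: "f \<in> borel_measurable (torus N)"
    and g: "\<And>n::nat. approximable N (g n)"
    and lim: "\<And>\<zeta>. \<zeta> \<in> space (torus N) \<Longrightarrow> (\<lambda>n. g n \<zeta>) \<longlonglongrightarrow> f \<zeta>"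
    and w: "integrable (torus N) w"
    and bound: "\<And>n \<zeta>. \<zeta> \<in> space (torus N) \<Longrightarrow> (cmod (g n \<zeta>))\<^sup>2 \<le> w \<zeta>"
  shows "approximable N f"
proof (rule approximable_closed)
  have bf: "(cmod (f \<zeta>))\<^sup>2 \<le> w \<zeta>" if "\<zeta> \<in> space (torus N)" for \<zeta>
  proof (rule LIMSEQ_le_const2)
    show "(\<lambda>n. (cmod (g n \<zeta>))\<^sup>2) \<longlonglongrightarrow> (cmod (f \<zeta>))\<^sup>2"
      by (intro tendsto_intros lim that)
  qed (use bound[OF that] in auto)
  show fL2: "f \<in> L2 N"
    by (rule L2_I_dominated[OF f w bf])
  have meas: "g n \<in> borel_measurable (torus N)" for n
    by (intro L2_measurable approximable_L2 g)
  have "(\<lambda>n. LINT \<zeta>|torus N. (cmod (f \<zeta> - g n \<zeta>))\<^sup>2) \<longlonglongrightarrow> (LINT \<zeta>|torus N. 0)"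
  proof (rule integral_dominated_convergence)
    show "integrable (torus N) (\<lambda>\<zeta>. 4 * w \<zeta>)" using w by simp
    show "AE \<zeta> in torus N. (\<lambda>n. (cmod (f \<zeta> - g n \<zeta>))\<^sup>2) \<longlonglongrightarrow> 0"
    proof (rule AE_I2)
      fix \<zeta> assume "\<zeta> \<in> space (torus N)"
      from lim[OF this] have "(\<lambda>n. (cmod (f \<zeta> - g n \<zeta>))\<^sup>2) \<longlonglongrightarrow> (cmod (f \<zeta> - f \<zeta>))\<^sup>2"
        by (intro tendsto_intros)
      then show "(\<lambda>n. (cmod (f \<zeta> - g n \<zeta>))\<^sup>2) \<longlonglongrightarrow> 0" by simp
    qed
    fix n
    show "AE \<zeta> in torus N. norm ((cmod (f \<zeta> - g n \<zeta>))\<^sup>2) \<le> 4 * w \<zeta>"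
    proof (rule AE_I2)
      fix \<zeta> assume "\<zeta> \<in> space (torus N)"
      then show "norm ((cmod (f \<zeta> - g n \<zeta>))\<^sup>2) \<le> 4 * w \<zeta>"
        using cmod_add_square_le[of "f \<zeta>" "- g n \<zeta>"] bf[of \<zeta>] bound[of \<zeta> n] by simp
    qed
  qed (use f meas in auto)
  then have lim0: "(\<lambda>n. LINT \<zeta>|torus N. (cmod (f \<zeta> - g n \<zeta>))\<^sup>2) \<longlonglongrightarrow> 0" by simp
  fix \<epsilon> :: real assume "\<epsilon> > 0"
  from order_tendstoD(2)[OF lim0 this]
  show "\<exists>g. approximable N g \<and> (LINT \<zeta>|torus N. (cmod (f \<zeta> - g \<zeta>))\<^sup>2) < \<epsilon>"
    using g by (auto simp: eventually_sequentially)
qed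

section \<open>Density of the trigonometric polynomials\<close>

text \<open>A product over all of \<open>nat\<close> is what the product topology on functions speaks about; the
  coordinates from \<open>N\<close> on are fixed at the default value of extensional functions.\<close>

lemma torus_PiE: "space (torus N) = (\<Pi>\<^sub>E j\<in>(UNIV::nat set). if j < N then sphere (0::complex) 1 else {undefined})" (is "_ = ?B")
proof (rule set_eqI)
  fix \<zeta> :: "nat \<Rightarrow> complex"
  have "\<zeta> \<in> space (torus N) \<longleftrightarrow> (\<forall>j. (j < N \<longrightarrow> \<zeta> j \<in> sphere 0 1) \<and> (\<not> j < N \<longrightarrow> \<zeta> j = undefined))"
    unfolding space_torus PiE_iff extensional_def by blast
  also have "\<dots> \<longleftrightarrow> (\<forall>j. \<zeta> j \<in> (if j < N then sphere (0::complex) 1 else {undefined}))"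
    by (simp del: mem_sphere)
  also have "\<dots> \<longleftrightarrow> \<zeta> \<in> ?B" 
    unfolding PiE_UNIV_domain Pi_iff by blast
  finally show "\<zeta> \<in> space (torus N) \<longleftrightarrow> \<zeta> \<in> ?B" .
qed
lemma compact_torus: "compact (space (torus N))"
proof -
  let ?S = "\<lambda>j. if j < N then sphere (0::complex) 1 else {undefined}"
  have c: "compactin euclidean (?S j)" for j
    unfolding compactin_euclidean_iff by simp
  have "compactin (product_topology (\<lambda>_. euclidean) UNIV) (PiE UNIV ?S)"
    unfolding compactin_PiE using c by blast
  then have "compactin euclidean (PiE UNIV ?S)"
    unfolding euclidean_product_topology .
  then have "compact (PiE UNIV ?S)"
    unfolding compactin_euclidean_iff .
  then show ?thesis
    unfolding torus_PiE .
qed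

text \<open>Real-valued trigonometric polynomials form an algebra. The real and imaginary parts of
  the coordinates belong to it and separate points, so by Stone--Weierstrass it is uniformly dense,
  and the torus has total mass \<open>1\<close>.\<close>

lemma approximable_continuous:
  fixes h :: "(nat \<Rightarrow> complex) \<Rightarrow> real"
  assumes h: "continuous_on (space (torus N)) h"
    and meas: "h \<in> borel_measurable (torus N)"
  shows "approximable N (\<lambda>\<zeta>. of_real (h \<zeta>))"
proof -
  interpret prob_space "torus N" by (rule prob_space_torus)
  let ?R = "{f::(nat \<Rightarrow> complex) \<Rightarrow> real.
    continuous_on (space (torus N)) f \<and> trig_poly N UNIV (\<lambda>\<zeta>. of_real (f \<zeta>))}"
  have coord: "trig_poly N UNIV (\<lambda>\<zeta>. \<zeta> j)" if "j < N" for j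
  proof -
    have "monomial N (\<lambda>i. if i = j then 1 else 0) \<zeta> = \<zeta> j" for \<zeta>
    proof -
      have "monomial N (\<lambda>i. if i = j then 1 else 0) \<zeta> = (\<Prod>i<N. if i = j then \<zeta> i else 1)"
        unfolding monomial_def by (intro prod.cong) auto
      then show ?thesis using that by simp
    qed
    then show ?thesis
      using trig_poly_term[of "\<lambda>i. if i = j then 1 else 0" UNIV N 1] by simp
  qed
  have re: "trig_poly N UNIV (\<lambda>\<zeta>. of_real (Re (\<zeta> j)))" if "j < N" for j
  proof (rule trig_poly.cong)
    show "trig_poly N UNIV (\<lambda>\<zeta>. (1/2) * (\<zeta> j + cnj (\<zeta> j)))"
      by (intro trig_poly_mult trig_poly_add trig_poly_const trig_poly_cnj[OF coord] coord that) auto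
  qed (simp add: complex_add_cnj)
  have im: "trig_poly N UNIV (\<lambda>\<zeta>. of_real (Im (\<zeta> j)))" if "j < N" for j
  proof (rule trig_poly.cong)
    show "trig_poly N UNIV (\<lambda>\<zeta>. (- \<i> / 2) * (\<zeta> j + (-1) * cnj (\<zeta> j)))"
      by (intro trig_poly_mult trig_poly_add trig_poly_const trig_poly_cnj[OF coord] coord that) auto
  qed (simp add: complex_eq_iff)
  interpret function_ring_on ?R "space (torus N)"
  proof
    show "compact (space (torus N))" by (rule compact_torus)
  next
    fix f assume "f \<in> ?R"
    then show "continuous_on (space (torus N)) f" by simp
  next
    fix f g assume "f \<in> ?R" "g \<in> ?R"
    then show "(\<lambda>x. f x + g x) \<in> ?R"
      by (auto intro: continuous_on_add trig_poly_add)
  next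
    fix f g assume "f \<in> ?R" "g \<in> ?R"
    then show "(\<lambda>x. f x * g x) \<in> ?R"
      by (auto intro: continuous_on_mult trig_poly_mult)
  next
    fix c show "(\<lambda>_. c) \<in> ?R" by (auto intro: trig_poly_const)
  next
    fix x y assume xy: "x \<in> space (torus N)" "y \<in> space (torus N)" "x \<noteq> y"
    then obtain j where j: "j < N" "x j \<noteq> y j"
      unfolding space_torus by (metis PiE_ext lessThan_iff)
    then have "Re (x j) \<noteq> Re (y j) \<or> Im (x j) \<noteq> Im (y j)"
      by (simp add: complex_eq_iff)
    moreover have "continuous_on (space (torus N)) (\<lambda>\<zeta>. \<zeta> j)"
      by (rule continuous_on_subset[OF continuous_on_product_coordinates]) simp
    then have "(\<lambda>\<zeta>. Re (\<zeta> j)) \<in> ?R" "(\<lambda>\<zeta>. Im (\<zeta> j)) \<in> ?R"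
      using re[OF j(1)] im[OF j(1)] by (simp_all add: continuous_on_Re continuous_on_Im)
    ultimately show "\<exists>f\<in>?R. f x \<noteq> f y"
      by (elim disjE) (erule bexI[rotated], assumption)+
  qed
  obtain C where C: "\<And>\<zeta>. \<zeta> \<in> space (torus N) \<Longrightarrow> \<bar>h \<zeta>\<bar> \<le> C"
    using compact_imp_bounded[OF compact_continuous_image[OF h compact_torus]]
    by (auto simp: bounded_iff)
  have hL2: "(\<lambda>\<zeta>. complex_of_real (h \<zeta>)) \<in> L2 N"
    by (rule L2_bounded[where C = C]) (use meas C in auto)
  show ?thesis
    unfolding approximable_def
  proof (intro conjI hL2 allI impI)
    fix \<epsilon> :: real assume "\<epsilon> > 0"
    define \<delta> where "\<delta> = sqrt (\<epsilon> / 2)"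
    have \<delta>: "\<delta> > 0" "\<delta>\<^sup>2 < \<epsilon>" using \<open>\<epsilon> > 0\<close> by (auto simp: \<delta>_def)
    obtain g where g: "g \<in> ?R" "\<And>\<zeta>. \<zeta> \<in> space (torus N) \<Longrightarrow> \<bar>h \<zeta> - g \<zeta>\<bar> < \<delta>"
      using Stone_Weierstrass_basic[OF h \<delta>(1)] by blast
    have gL2: "(\<lambda>\<zeta>. complex_of_real (g \<zeta>)) \<in> L2 N"
      using g(1) by (auto intro: trig_poly_L2)
    have "(LINT \<zeta>|torus N. (cmod (of_real (h \<zeta>) - of_real (g \<zeta>)))\<^sup>2) \<le> (LINT \<zeta>|torus N. \<delta>\<^sup>2)"
    proof (intro integral_mono L2_integrable_square L2_diff hL2 gL2)
      fix \<zeta> assume "\<zeta> \<in> space (torus N)"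
      then show "(cmod (of_real (h \<zeta>) - of_real (g \<zeta>)))\<^sup>2 \<le> \<delta>\<^sup>2"
        using g(2)[of \<zeta>] \<delta>(1) by (intro power_mono) (auto simp flip: of_real_diff)
    qed simp
    also have "\<dots> < \<epsilon>" using \<delta>(2) prob_space by simp
    finally show "\<exists>p. trig_poly N UNIV p \<and>
        (LINT \<zeta>|torus N. (cmod (of_real (h \<zeta>) - p \<zeta>))\<^sup>2) < \<epsilon>"
      using g(1) by blast
  qed
qed

lemma closed_indicator_limit:
  fixes A :: "'a::metric_space set"
  assumes "closed A"
  shows "\<exists>h :: nat \<Rightarrow> 'a \<Rightarrow> real. (\<forall>n. continuous_on UNIV (h n)) \<and>
    (\<forall>n z. 0 \<le> h n z \<and> h n z \<le> 1) \<and> (\<forall>z. (\<lambda>n. h n z) \<longlonglongrightarrow> indicator A z)"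
proof (cases "A = {}")
  case True
  then show ?thesis by (intro exI[of _ "\<lambda>_ _. 0"]) auto
next
  case False
  define h where "h n z = max 0 (1 - real n * infdist z A)" for n z
  have "(\<lambda>n. h n z) \<longlonglongrightarrow> indicator A z" for z
  proof (cases "z \<in> A")
    case True
    then show ?thesis by (simp add: h_def)
  next
    case nz: False
    then have pos: "infdist z A > 0"
      using assms False by (simp add: infdist_pos_not_in_closed)
    then obtain m where m: "1 < real m * infdist z A"
      using reals_Archimedean3 by blast
    have "h n z = 0" if "m \<le> n" for n
    proof -
      have "real m * infdist z A \<le> real n * infdist z A"
        using that pos by (intro mult_right_mono) auto
      with m show ?thesis by (simp add: h_def)
    qed
    then have "eventually (\<lambda>n. h n z = indicator A z) sequentially"
      using nz by (auto simp: eventually_sequentially)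
    then show ?thesis by (rule tendsto_eventually)
  qed
  moreover have "continuous_on UNIV (h n)" for n
    unfolding h_def by (intro continuous_intros)
  moreover have "0 \<le> h n z \<and> h n z \<le> 1" for n z
    by (simp add: h_def infdist_nonneg)
  ultimately show ?thesis by blast
qed

text \<open>The indicator of a box is the limit of products of continuous functions of one coordinate each;
  these products are continuous on the torus and bounded by \<open>1\<close>.\<close>

lemma approximable_closed_box:
  assumes "\<And>j. j < N \<Longrightarrow> closed (A j)"
  shows "approximable N (indicator {\<zeta> \<in> space (torus N). \<forall>j<N. \<zeta> j \<in> A j})" 
  (is "approximable N (indicator ?B)")
proof -
  interpret prob_space "torus N" by (rule prob_space_torus)
  have "\<forall>j\<in>{..<N}. \<exists>h :: nat \<Rightarrow> complex \<Rightarrow> real. (\<forall>n. continuous_on UNIV (h n)) \<and>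
    (\<forall>n z. 0 \<le> h n z \<and> h n z \<le> 1) \<and> (\<forall>z. (\<lambda>n. h n z) \<longlonglongrightarrow> indicator (A j) z)"
    using closed_indicator_limit assms by blast
  then obtain h :: "nat \<Rightarrow> nat \<Rightarrow> complex \<Rightarrow> real" where
    h1: "\<And>j n. j < N \<Longrightarrow> continuous_on UNIV (h j n)" and
    h2: "\<And>j n z. j < N \<Longrightarrow> 0 \<le> h j n z \<and> h j n z \<le> 1" and
    h3: "\<And>j z. j < N \<Longrightarrow> (\<lambda>n. h j n z) \<longlonglongrightarrow> indicator (A j) z"
    unfolding bchoice_iff by (metis lessThan_iff)
  define F where "F n \<zeta> = (\<Prod>j<N. h j n (\<zeta> j))" for n and \<zeta> :: "nat \<Rightarrow> complex"
  have mF: "F n \<in> borel_measurable (torus N)" for n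
    unfolding F_def
    by (intro borel_measurable_prod measurable_compose[OF measurable_torus_coord]
        borel_measurable_continuous_onI h1) auto
  have bF: "0 \<le> F n \<zeta> \<and> F n \<zeta> \<le> 1" for n \<zeta>
    unfolding F_def using h2 by (auto intro!: prod_nonneg prod_le_1)
  have lF: "(\<lambda>n. F n \<zeta>) \<longlonglongrightarrow> indicator ?B \<zeta>" if "\<zeta> \<in> space (torus N)" for \<zeta>
  proof -
    have "(\<lambda>n. F n \<zeta>) \<longlonglongrightarrow> (\<Prod>j<N. indicator (A j) (\<zeta> j))"
      unfolding F_def by (intro tendsto_prod h3) simp
    also have "(\<Prod>j<N. indicator (A j) (\<zeta> j)) = (indicator ?B \<zeta> :: real)"
    proof (cases "\<forall>j<N. \<zeta> j \<in> A j")
      case True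
      then show ?thesis using that by (simp add: indicator_def)
    next
      case False
      then have "\<exists>j\<in>{..<N}. indicator (A j) (\<zeta> j) = (0::real)"
        by (auto simp: indicator_def)
      then have "(\<Prod>j<N. indicator (A j) (\<zeta> j)) = (0::real)"
        by (simp add: prod_zero_iff)
      with False show ?thesis by (simp add: indicator_def)
    qed
    finally show ?thesis .
  qed
  have cF: "continuous_on (space (torus N)) (F n)" for n
    unfolding F_def
  proof (intro continuous_on_prod)
    fix j assume "j \<in> {..<N}"
    then have "continuous_on UNIV (h j n)" using h1 by simp
    moreover have "continuous_on (space (torus N)) (\<lambda>\<zeta>. \<zeta> j)"
      by (rule continuous_on_subset[OF continuous_on_product_coordinates]) simp
    ultimately show "continuous_on (space (torus N)) (\<lambda>\<zeta>. h j n (\<zeta> j))"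
      by (rule continuous_on_compose2) simp
  qed
  have lF': "(\<lambda>n. complex_of_real (F n \<zeta>)) \<longlonglongrightarrow> indicator ?B \<zeta>" if "\<zeta> \<in> space (torus N)" for \<zeta>
    using tendsto_of_real[OF lF[OF that], where 'a = complex] by (cases "\<zeta> \<in> ?B") simp_all
  show ?thesis
  proof (rule approximable_dominated_limit[where g = "\<lambda>n \<zeta>. of_real (F n \<zeta>)" and w = "\<lambda>_. 1"])
    show "(indicator ?B :: _ \<Rightarrow> complex) \<in> borel_measurable (torus N)"
      by (rule borel_measurable_LIMSEQ_metric[where f = "\<lambda>n \<zeta>. of_real (F n \<zeta>)"])
         (use mF lF' in auto)
    show "approximable N (\<lambda>\<zeta>. complex_of_real (F n \<zeta>))" for n
      by (rule approximable_continuous[OF cF mF])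
    show "(\<lambda>n. complex_of_real (F n \<zeta>)) \<longlonglongrightarrow> indicator ?B \<zeta>" if "\<zeta> \<in> space (torus N)" for \<zeta>
      by (rule lF'[OF that])
    show "(cmod (complex_of_real (F n \<zeta>)))\<^sup>2 \<le> 1" for n \<zeta>
      using bF[of n \<zeta>] by (simp add: power_le_one)
  qed simp
qed

text \<open>The generator consists of closed sets because these are the ones whose indicators are limits of
  continuous functions.\<close>

lemma sets_circle_haar_closed:
  "sets circle_haar = sets (sigma (sphere 0 1) {C. closed C \<and> C \<subseteq> sphere 0 1})"
proof -
  let ?S = "sphere (0::complex) 1"
  have "sets (restrict_space borel ?S) = (\<inter>) ?S ` sigma_sets UNIV (Collect closed)"
    by (simp add: sets_restrict_space borel_eq_closed)
  also have "\<dots> = sigma_sets ?S ((\<inter>) ?S ` Collect closed)"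
    by (rule sigma_sets_Int) (auto intro: sigma_sets.Basic)
  also have "(\<inter>) ?S ` Collect closed = {C. closed C \<and> C \<subseteq> ?S}"
  proof (intro equalityI subsetI)
    fix C assume "C \<in> {C. closed C \<and> C \<subseteq> ?S}"
    then show "C \<in> (\<inter>) ?S ` Collect closed"
      by (intro image_eqI[of _ _ C]) auto
  qed (auto intro: closed_Int)
  finally show ?thesis
    by (simp add: sets_circle_haar subset_iff)
qed

lemma sets_torus:
  "sets (torus N) = sigma_sets (space (torus N))
    {{\<zeta> \<in> space (torus N). \<forall>j<N. \<zeta> j \<in> A j} | A. \<forall>j<N. closed (A j) \<and> A j \<subseteq> sphere 0 1}"
proof -
  let ?E = "{C::complex set. closed C \<and> C \<subseteq> sphere 0 1}"
  have "sets (torus N) = sets (\<Pi>\<^sub>M j\<in>{..<N}. sigma (sphere 0 1) ?E)"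
    unfolding torus_def by (intro sets_PiM_cong sets_circle_haar_closed refl)
  also have "\<dots> = sets (sigma (\<Pi>\<^sub>E j\<in>{..<N}. sphere 0 1)
      {{f \<in> \<Pi>\<^sub>E j\<in>{..<N}. sphere 0 1. \<forall>i\<in>j. f i \<in> A i} | A j. j \<in> {{..<N}} \<and> A \<in> Pi j (\<lambda>_. ?E)})"
    by (intro sets_PiM_sigma) (auto intro!: exI[of _ "{sphere 0 1}"])
  also have "\<dots> = sigma_sets (space (torus N))
      {{f \<in> \<Pi>\<^sub>E j\<in>{..<N}. sphere 0 1. \<forall>i\<in>j. f i \<in> A i} | A j. j \<in> {{..<N}} \<and> A \<in> Pi j (\<lambda>_. ?E)}"
    unfolding space_torus by (intro sets_measure_of) auto
  also have "{{f \<in> \<Pi>\<^sub>E j\<in>{..<N}. sphere 0 1. \<forall>i\<in>j. f i \<in> A i} | A j. j \<in> {{..<N}} \<and> A \<in> Pi j (\<lambda>_. ?E)}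
      = {{\<zeta> \<in> space (torus N). \<forall>j<N. \<zeta> j \<in> A j} | A. \<forall>j<N. closed (A j) \<and> A j \<subseteq> sphere 0 1}"
    unfolding space_torus by (simp add: Pi_iff Ball_def)
  finally show ?thesis .
qed

text \<open>Closed boxes form an intersection-stable generator, and the sets with approximable indicator are
  closed under complements and countable disjoint unions.\<close>

lemma approximable_indicator:
  assumes "B \<in> sets (torus N)"
  shows "approximable N (indicator B)"
proof -
  interpret prob_space "torus N" by (rule prob_space_torus)
  let ?G = "{{\<zeta> \<in> space (torus N). \<forall>j<N. \<zeta> j \<in> A j} | A. \<forall>j<N. closed (A j) \<and> A j \<subseteq> sphere 0 1}"
  have "Int_stable ?G"
  proof (rule Int_stableI)
    fix B B' assume "B \<in> ?G" "B' \<in> ?G"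
    then obtain A A' where A: "\<forall>j<N. closed (A j) \<and> A j \<subseteq> sphere 0 1"
        "\<forall>j<N. closed (A' j) \<and> A' j \<subseteq> sphere 0 1"
      and B: "B = {\<zeta> \<in> space (torus N). \<forall>j<N. \<zeta> j \<in> A j}"
        "B' = {\<zeta> \<in> space (torus N). \<forall>j<N. \<zeta> j \<in> A' j}"
      by blast
    have "B \<inter> B' = {\<zeta> \<in> space (torus N). \<forall>j<N. \<zeta> j \<in> A j \<inter> A' j}"
      unfolding B by blast
    moreover have "\<forall>j<N. closed (A j \<inter> A' j) \<and> A j \<inter> A' j \<subseteq> sphere 0 1"
      using A by (simp add: closed_Int le_infI1)
    ultimately show "B \<inter> B' \<in> ?G"
      by (intro CollectI exI[of _ "\<lambda>j. A j \<inter> A' j"] conjI)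
  qed
  moreover have "?G \<subseteq> Pow (space (torus N))" by blast
  moreover have "B \<in> sigma_sets (space (torus N)) ?G"
    using assms sets_torus[of N] by simp
  ultimately show ?thesis
  proof (induction rule: sigma_sets_induct_disjoint)
    case (basic B)
    then show ?case using approximable_closed_box by blast
  next
    case empty
    then show ?case by (simp add: indicator_def approximable_trig_poly trig_poly.zero)
  next
    case (compl B)
    have "approximable N (\<lambda>\<zeta>. 1 + (-1) * indicator B \<zeta>)"
      by (intro approximable_add approximable_scale compl approximable_trig_poly trig_poly_const)
    then show ?case
    proof (rule approximable_cong)
      fix \<zeta> assume "\<zeta> \<in> space (torus N)"
      then show "indicator (space (torus N) - B) \<zeta> = (1 + (-1) * indicator B \<zeta> :: complex)"
        by (simp add: indicator_def)
    qed
  next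
    case (union B)
    have B: "B i \<in> sets (torus N)" for i
      using union.hyps(2) sets_torus[of N] by blast
    show ?case
    proof (rule approximable_dominated_limit[where w = "\<lambda>_. 1"])
      show "approximable N (\<lambda>\<zeta>. \<Sum>i<n. indicator (B i) \<zeta>)" for n
        by (intro approximable_sum union)
      have eq: "(\<Sum>i<n. indicator (B i) \<zeta>) = (indicator (\<Union>i<n. B i) \<zeta> :: complex)" for n \<zeta>
        by (rule indicator_UN_disjoint[symmetric])
           (use union.hyps(1) in \<open>auto simp: disjoint_family_on_def\<close>)
      show "(\<lambda>n. \<Sum>i<n. indicator (B i) \<zeta>) \<longlonglongrightarrow> (indicator (\<Union>i. B i) \<zeta> :: complex)" for \<zeta>
        unfolding eq by (rule LIMSEQ_indicator_UN)
      show "(cmod (\<Sum>i<n. indicator (B i) \<zeta>))\<^sup>2 \<le> 1" for n \<zeta>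
        unfolding eq by (simp add: indicator_def)
      show "(indicator (\<Union>i. B i) :: _ \<Rightarrow> complex) \<in> borel_measurable (torus N)"
        using B by (intro borel_measurable_indicator) auto
    qed simp
  qed
qed

text \<open>Simple functions are combinations of indicators, and \<open>f\<close> is their limit with dominating function
  \<open>4 |f|\<^sup>2\<close>.\<close>

theorem L2_approximable:
  assumes f: "f \<in> L2 N"
  shows "approximable N f"
proof -
  obtain s where s: "\<And>i. simple_function (torus N) (s i)"
    "\<And>x. x \<in> space (torus N) \<Longrightarrow> (\<lambda>i. s i x) \<longlonglongrightarrow> f x"
    "\<And>i x. x \<in> space (torus N) \<Longrightarrow> cmod (s i x) \<le> 2 * cmod (f x)"
    using borel_measurable_implies_sequence_metric[OF L2_measurable[OF f], of 0]
    unfolding norm_conv_dist[symmetric] by blast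
  show ?thesis
  proof (rule approximable_dominated_limit[where g = s and w = "\<lambda>\<zeta>. 4 * (cmod (f \<zeta>))\<^sup>2"])
    show "(cmod (s n \<zeta>))\<^sup>2 \<le> 4 * (cmod (f \<zeta>))\<^sup>2" if "\<zeta> \<in> space (torus N)" for n \<zeta>
      using power_mono[OF s(3)[OF that, of n], of 2] by (simp add: power_mult_distrib)
    fix n
    let ?V = "s n ` space (torus N)"
    have fin: "finite ?V"
      using s(1) by (rule simple_functionD)
    have "approximable N (\<lambda>\<zeta>. \<Sum>y\<in>?V. y * indicator (s n -` {y} \<inter> space (torus N)) \<zeta>)"
      by (intro approximable_sum approximable_scale approximable_indicator simple_functionD s(1))
    then show "approximable N (s n)"
    proof (rule approximable_cong)
      fix \<zeta> assume \<zeta>: "\<zeta> \<in> space (torus N)"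
      have "(\<Sum>y\<in>?V. y * indicator (s n -` {y} \<inter> space (torus N)) \<zeta>) = (\<Sum>y\<in>?V. if y = s n \<zeta> then y else 0)"
        using \<zeta> by (intro sum.cong) (auto simp: indicator_def)
      also have "\<dots> = s n \<zeta>"
        using \<zeta> fin by simp
      finally show "s n \<zeta> = (\<Sum>y\<in>?V. y * indicator (s n -` {y} \<inter> space (torus N)) \<zeta>)" ..
    qed
  qed (use s f in \<open>auto intro: L2_measurable simp: L2_integrable_square\<close>)
qed

section \<open>The Hardy space\<close>

lemma fourier_coeff_cong: "(\<And>j. j < N \<Longrightarrow> \<alpha> j = \<beta> j) \<Longrightarrow> fourier_coeff N f \<alpha> = fourier_coeff N f \<beta>"
  unfolding fourier_coeff_def by (subst monomial_cong[where \<beta> = "\<lambda>j. - \<beta> j"]) auto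

lemma H2_L2: "f \<in> H2 N \<Longrightarrow> f \<in> L2 N"
  by (simp add: H2_def)

lemma H2_fourier_coeff: "f \<in> H2 N \<Longrightarrow> j < N \<Longrightarrow> \<alpha> j < 0 \<Longrightarrow> fourier_coeff N f \<alpha> = 0"
  unfolding H2_def by (auto simp: not_le)

lemma fourier_coeff_monomial_mult:
  "(LINT \<zeta>|torus N. monomial N \<gamma> \<zeta> * (f \<zeta> * monomial N (\<lambda>j. - \<alpha> j) \<zeta>))
    = fourier_coeff N f (\<lambda>j. \<alpha> j - \<gamma> j)"
  unfolding fourier_coeff_def
proof (rule Bochner_Integration.integral_cong[OF refl])
  fix \<zeta> assume "\<zeta> \<in> space (torus N)"
  then show "monomial N \<gamma> \<zeta> * (f \<zeta> * monomial N (\<lambda>j. - \<alpha> j) \<zeta>)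
    = f \<zeta> * monomial N (\<lambda>j. - (\<alpha> j - \<gamma> j)) \<zeta>"
    using monomial_mult[of \<zeta> N \<gamma> "\<lambda>j. - \<alpha> j"] by (simp add: mult.left_commute)
qed

lemma integral_monomial_mult:
  "(LINT \<zeta>|torus N. monomial N \<alpha> \<zeta> * monomial N \<beta> \<zeta>) = (if \<forall>j<N. \<alpha> j + \<beta> j = 0 then 1 else 0)"
  using integral_monomial[of N "\<lambda>j. \<alpha> j + \<beta> j"]
  by (simp add: monomial_mult cong: Bochner_Integration.integral_cong)

definition nonneg_indices :: "nat \<Rightarrow> (nat \<Rightarrow> int) set" where
  "nonneg_indices N = {\<alpha>. \<forall>j<N. 0 \<le> \<alpha> j}"

lemma H2_integral_cnj_nonanalytic:
  assumes "f \<in> H2 N" "trig_poly N (- nonneg_indices N) r"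
  shows "(LINT \<zeta>|torus N. cnj (r \<zeta>) * f \<zeta>) = 0"
proof (rule integral_trig_poly_mult_eq_0)
  show "trig_poly N {\<alpha>. (\<lambda>j. - \<alpha> j) \<notin> nonneg_indices N} (\<lambda>\<zeta>. cnj (r \<zeta>))"
    using assms(2) by (rule trig_poly_cnj) simp
  show "f \<in> L2 N" using assms(1) by (rule H2_L2)
  fix \<alpha> assume "\<alpha> \<in> {\<alpha>. (\<lambda>j. - \<alpha> j) \<notin> nonneg_indices N}"
  then show "(LINT \<zeta>|torus N. monomial N \<alpha> \<zeta> * f \<zeta>) = 0"
    using assms(1) unfolding H2_def nonneg_indices_def fourier_coeff_def
    by (auto simp: mult.commute dest!: spec[of _ "\<lambda>j. - \<alpha> j"])
qed

lemma analytic_trig_poly_H2: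
  assumes "trig_poly N (nonneg_indices N) q"
  shows "q \<in> H2 N"
  unfolding H2_def
proof (intro CollectI conjI allI impI)
  show "q \<in> L2 N" using assms by (rule trig_poly_L2)
  fix \<alpha> :: "nat \<Rightarrow> int" assume \<alpha>: "\<not> (\<forall>j<N. 0 \<le> \<alpha> j)"
  show "fourier_coeff N q \<alpha> = 0"
    unfolding fourier_coeff_def
  proof (rule integral_trig_poly_mult_eq_0[OF assms monomial_L2])
    fix \<beta> assume "\<beta> \<in> nonneg_indices N"
    with \<alpha> have "\<not> (\<forall>j<N. \<beta> j + - \<alpha> j = 0)"
      by (force simp: nonneg_indices_def)
    then show "(LINT \<zeta>|torus N. monomial N \<beta> \<zeta> * monomial N (\<lambda>j. - \<alpha> j) \<zeta>) = 0"
      unfolding integral_monomial_mult by argo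
  qed
qed

text \<open>If \<open>p = q + r\<close> approximates \<open>f\<close>, with \<open>q\<close> the analytic part, then \<open>r\<close> is orthogonal to
  \<open>f - q\<close>. By Pythagoras, dropping \<open>r\<close> can only improve the approximation.\<close>

theorem H2_analytic_polynomials_dense:
  assumes f: "f \<in> H2 N" and "\<epsilon> > 0"
  shows "\<exists>q. trig_poly N (nonneg_indices N) q \<and> (LINT \<zeta>|torus N. (cmod (f \<zeta> - q \<zeta>))\<^sup>2) < \<epsilon>"
proof -
  obtain p where p: "trig_poly N UNIV p" "(LINT \<zeta>|torus N. (cmod (f \<zeta> - p \<zeta>))\<^sup>2) < \<epsilon>"
    using L2_approximable[OF H2_L2[OF f]] \<open>\<epsilon> > 0\<close> unfolding approximable_def by blast
  obtain q r where qr: "trig_poly N (nonneg_indices N) q" "trig_poly N (- nonneg_indices N) r"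
    "\<forall>\<zeta>\<in>space (torus N). p \<zeta> = q \<zeta> + r \<zeta>"
    using trig_poly_split[OF p(1)] by blast
  have L2: "f \<in> L2 N" "q \<in> L2 N" "r \<in> L2 N" "(\<lambda>\<zeta>. f \<zeta> - q \<zeta>) \<in> L2 N" "(\<lambda>\<zeta>. cnj (r \<zeta>)) \<in> L2 N"
    using f qr by (auto intro: H2_L2 trig_poly_L2 L2_diff L2_cnj)
  have orth: "(LINT \<zeta>|torus N. cnj (r \<zeta>) * (f \<zeta> - q \<zeta>)) = 0"
    using H2_integral_cnj_nonanalytic[OF f qr(2)] H2_integral_cnj_nonanalytic[OF analytic_trig_poly_H2[OF qr(1)] qr(2)]
      integrable_L2_mult[OF L2(5,1)] integrable_L2_mult[OF L2(5,2)]
    by (simp add: right_diff_distrib)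
  have "(LINT \<zeta>|torus N. (cmod (f \<zeta> - p \<zeta>))\<^sup>2)
      = (LINT \<zeta>|torus N. (cmod (f \<zeta> - q \<zeta>))\<^sup>2 + (cmod (r \<zeta>))\<^sup>2 - 2 * Re (cnj (r \<zeta>) * (f \<zeta> - q \<zeta>)))"
  proof (rule Bochner_Integration.integral_cong[OF refl])
    fix \<zeta> assume "\<zeta> \<in> space (torus N)"
    then have "f \<zeta> - p \<zeta> = (f \<zeta> - q \<zeta>) - r \<zeta>" using qr(3) by simp
    moreover have "(cmod (a - b))\<^sup>2 = (cmod a)\<^sup>2 + (cmod b)\<^sup>2 - 2 * Re (cnj b * a)" for a b
      unfolding cmod_power2 by (simp add: power2_eq_square algebra_simps)
    ultimately show "(cmod (f \<zeta> - p \<zeta>))\<^sup>2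
        = (cmod (f \<zeta> - q \<zeta>))\<^sup>2 + (cmod (r \<zeta>))\<^sup>2 - 2 * Re (cnj (r \<zeta>) * (f \<zeta> - q \<zeta>))"
      by presburger
  qed
  also have "\<dots> = (LINT \<zeta>|torus N. (cmod (f \<zeta> - q \<zeta>))\<^sup>2) + (LINT \<zeta>|torus N. (cmod (r \<zeta>))\<^sup>2)
      - 2 * Re (LINT \<zeta>|torus N. cnj (r \<zeta>) * (f \<zeta> - q \<zeta>))"
    unfolding integral_Re[OF integrable_L2_mult[OF L2(5,4)], symmetric]
    using L2_integrable_square[OF L2(4)] L2_integrable_square[OF L2(3)]
      integrable_Re[OF integrable_L2_mult[OF L2(5,4)]]
    by (simp only: Bochner_Integration.integral_diff Bochner_Integration.integral_add
        Bochner_Integration.integrable_add integrable_mult_right integral_mult_right_zero)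
  also have "\<dots> \<ge> (LINT \<zeta>|torus N. (cmod (f \<zeta> - q \<zeta>))\<^sup>2)"
    unfolding orth by (simp add: integral_nonneg_AE)
  finally show ?thesis using p(2) qr(1) by (intro exI[of _ q]) auto
qed

text \<open>This turns information about Fourier coefficients into information about integrals: a functional
  \<open>f \<mapsto> \<integral> f u\<close> is continuous in \<open>L\<^sup>2\<close>, so it vanishes on \<open>H\<^sup>2\<close> as soon as it vanishes on monomials.\<close>

theorem H2_integral_mult_eq_0:
  assumes f: "f \<in> H2 N" and u: "u \<in> L2 N"
    and u0: "\<And>\<gamma>. \<gamma> \<in> nonneg_indices N \<Longrightarrow> (LINT \<zeta>|torus N. monomial N \<gamma> \<zeta> * u \<zeta>) = 0"
  shows "(LINT \<zeta>|torus N. f \<zeta> * u \<zeta>) = 0"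
proof -
  define U where "U = (LINT \<zeta>|torus N. (cmod (u \<zeta>))\<^sup>2)"
  have "U \<ge> 0" unfolding U_def by (intro integral_nonneg_AE) auto
  have bound: "cmod (LINT \<zeta>|torus N. f \<zeta> * u \<zeta>) \<le> \<epsilon> * (1 + U)" if "\<epsilon> > 0" for \<epsilon>
  proof -
    obtain q where q: "trig_poly N (nonneg_indices N) q"
      "(LINT \<zeta>|torus N. (cmod (f \<zeta> - q \<zeta>))\<^sup>2) < \<epsilon>\<^sup>2"
      using H2_analytic_polynomials_dense[OF f, of "\<epsilon>\<^sup>2"] \<open>\<epsilon> > 0\<close> by auto
    have L2: "f \<in> L2 N" "q \<in> L2 N" "(\<lambda>\<zeta>. f \<zeta> - q \<zeta>) \<in> L2 N"
      using f q by (auto intro: H2_L2 trig_poly_L2 L2_diff)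
    have "(LINT \<zeta>|torus N. f \<zeta> * u \<zeta>) = (LINT \<zeta>|torus N. (f \<zeta> - q \<zeta>) * u \<zeta>)"
      using integral_trig_poly_mult_eq_0[OF q(1) u u0] integrable_L2_mult[OF L2(1) u]
        integrable_L2_mult[OF L2(2) u]
      by (simp add: left_diff_distrib)
    also have "cmod \<dots> \<le> (LINT \<zeta>|torus N. cmod ((f \<zeta> - q \<zeta>) * u \<zeta>))"
      by (rule integral_norm_bound)
    also have "\<dots> \<le> (LINT \<zeta>|torus N. (cmod (f \<zeta> - q \<zeta>))\<^sup>2 / \<epsilon> + \<epsilon> * (cmod (u \<zeta>))\<^sup>2)"
    proof (intro integral_mono integrable_norm integrable_L2_mult L2 u)
      show "integrable (torus N) (\<lambda>\<zeta>. (cmod (f \<zeta> - q \<zeta>))\<^sup>2 / \<epsilon> + \<epsilon> * (cmod (u \<zeta>))\<^sup>2)"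
        using L2_integrable_square[OF L2(3)] L2_integrable_square[OF u] by simp
      \<comment> \<open>A weighted inequality between the means takes the place of Cauchy--Schwarz.\<close>
      have "a * b \<le> a\<^sup>2 / \<epsilon> + \<epsilon> * b\<^sup>2" if "a \<ge> 0" "b \<ge> 0" for a b :: real
      proof -
        have "0 \<le> (a - \<epsilon> * b)\<^sup>2 / \<epsilon> + a * b"
          using \<open>\<epsilon> > 0\<close> that by simp
        also have "\<dots> = a\<^sup>2 / \<epsilon> + \<epsilon> * b\<^sup>2 - a * b"
          using \<open>\<epsilon> > 0\<close> by (simp add: field_simps power2_eq_square)
        finally show ?thesis by simp
      qed
      then show "cmod ((f \<zeta> - q \<zeta>) * u \<zeta>) \<le> (cmod (f \<zeta> - q \<zeta>))\<^sup>2 / \<epsilon> + \<epsilon> * (cmod (u \<zeta>))\<^sup>2" for \<zeta>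
        by (simp add: norm_mult)
    qed
    also have "\<dots> = (LINT \<zeta>|torus N. (cmod (f \<zeta> - q \<zeta>))\<^sup>2) / \<epsilon> + \<epsilon> * U"
      unfolding U_def using L2_integrable_square[OF L2(3)] L2_integrable_square[OF u] by simp
    also have "\<dots> \<le> \<epsilon>\<^sup>2 / \<epsilon> + \<epsilon> * U"
      using q(2) \<open>\<epsilon> > 0\<close> by (intro add_right_mono divide_right_mono) auto
    also have "\<dots> = \<epsilon> * (1 + U)"
      using \<open>\<epsilon> > 0\<close> by (simp add: field_simps power2_eq_square)
    finally show ?thesis .
  qed
  have "cmod (LINT \<zeta>|torus N. f \<zeta> * u \<zeta>) \<le> 0"
  proof (rule field_le_epsilon)
    fix e :: real assume "e > 0"
    with bound[of "e / (1 + U)"] \<open>U \<ge> 0\<close>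
    show "cmod (LINT \<zeta>|torus N. f \<zeta> * u \<zeta>) \<le> 0 + e" by simp
  qed
  then show ?thesis by simp
qed

section \<open>Underdetermined linear systems\<close>

text \<open>Gaussian elimination: if equation \<open>w\<close> has a nonzero coefficient at \<open>v\<close>, it expresses the
  unknown \<open>c v\<close> through the others, and is used to remove \<open>v\<close> from the other equations.\<close>

lemma homogeneous_system_nontrivial:
  fixes M :: "'w \<Rightarrow> 'u \<Rightarrow> 'k::field"
  assumes "finite W" "finite U" "card W < card U"
  shows "\<exists>c. (\<exists>u\<in>U. c u \<noteq> 0) \<and> (\<forall>w\<in>W. (\<Sum>u\<in>U. M w u * c u) = 0)"
  using assms
proof (induction W arbitrary: U M rule: finite_induct)
  case empty
  then have "U \<noteq> {}" by auto
  then show ?case by (intro exI[of _ "\<lambda>_. 1"]) auto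
next
  case (insert w W)
  show ?case
  proof (cases "\<forall>u\<in>U. M w u = 0")
    case True
    have "card W < card U" using insert by simp
    from insert.IH[OF insert.prems(1) this, of M] True show ?thesis by auto
  next
    case False
    then obtain v where v: "v \<in> U" "M w v \<noteq> 0" by blast
    let ?U = "U - {v}"
    have "card W < card ?U" "finite ?U" using insert v by auto
    from insert.IH[OF this(2,1), of "\<lambda>w' u. M w' u - M w' v * M w u / M w v"]
    obtain c where c: "\<exists>u\<in>?U. c u \<noteq> 0"
      "\<And>w'. w' \<in> W \<Longrightarrow> (\<Sum>u\<in>?U. (M w' u - M w' v * M w u / M w v) * c u) = 0"
      by blast
    define d where "d = c(v := - (\<Sum>u\<in>?U. M w u * c u) / M w v)"
    have split: "(\<Sum>u\<in>U. M w' u * d u) = M w' v * d v + (\<Sum>u\<in>?U. M w' u * c u)" for w'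
      using insert.prems(1) v(1) by (subst sum.remove[of _ v]) (auto simp: d_def)
    have "(\<Sum>u\<in>U. M w' u * d u) = 0" if "w' \<in> W" for w'
    proof -
      have "(\<Sum>u\<in>?U. (M w' u - M w' v * M w u / M w v) * c u)
          = (\<Sum>u\<in>?U. M w' u * c u) - M w' v / M w v * (\<Sum>u\<in>?U. M w u * c u)"
        by (simp add: left_diff_distrib sum_subtractf sum_distrib_left mult.assoc)
      then show ?thesis
        using c(2)[OF that] unfolding split by (simp add: d_def)
    qed
    moreover have "(\<Sum>u\<in>U. M w u * d u) = 0"
      unfolding split using v(2) by (simp add: d_def)
    moreover have "\<exists>u\<in>U. d u \<noteq> 0"
      using c(1) by (auto simp: d_def)
    ultimately show ?thesis by (intro exI[of _ d]) auto
  qed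
qed

section \<open>Fourier coefficients of products\<close>

text \<open>The frequency of the monomial \<open>\<zeta>\<^sub>0^i \<zeta>\<^sub>1^j\<close> for \<open>u = (i, j)\<close>.\<close>

definition index2 :: "nat \<times> nat \<Rightarrow> nat \<Rightarrow> int" where
  "index2 u = (\<lambda>n. if n = 0 then int (fst u) else if n = 1 then int (snd u) else 0)"

lemma index2_nonneg: "index2 u \<in> nonneg_indices N"
  by (simp add: index2_def nonneg_indices_def)

lemma index2_eq_iff: "N > 1 \<Longrightarrow> (\<forall>n<N. index2 u n = index2 v n) \<longleftrightarrow> u = v"
  unfolding index2_def by (auto simp: prod_eq_iff dest: spec[of _ 0] spec[of _ 1])

text \<open>Put \<open>\<alpha> = (i, j)\<close>. Integrating \<open>g\<close> against \<open>\<phi> \<zeta>\<^sup>-\<^sup>\<alpha>\<close> gives the left-hand side, and integrating \<open>g\<close> against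
  \<open>\<Sum>\<^sub>\<beta> (coefficient of \<phi> at \<alpha> - \<beta>) * \<zeta>\<^sup>-\<^sup>\<beta>\<close>, with \<open>\<beta>\<close> ranging over the box below \<open>\<alpha>\<close>, gives the right-hand side. The
  difference \<open>u\<close> of these two functions has vanishing integral against every analytic monomial
  \<open>\<zeta>\<^sup>\<gamma>\<close>: for \<open>\<gamma>\<close> in the box the two contributions cancel, and otherwise \<open>\<alpha> - \<gamma>\<close> has a negative
  entry, where the coefficient of \<open>\<phi>\<close> is zero. So the two integrals against \<open>g\<close> agree.\<close>

lemma fourier_coeff_mult:
  assumes N: "N > 1" and \<phi>: "\<phi> \<in> H2 N" and g: "g \<in> H2 N"
  shows "fourier_coeff N (mult_op \<phi> g) (index2 (i, j)) =
    (\<Sum>(k, l)\<in>{..i} \<times> {..j}. fourier_coeff N \<phi> (index2 (i - k, j - l)) * fourier_coeff N g (index2 (k, l)))"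
proof -
  let ?B = "{..i} \<times> {..j}"
  define c where "c = (\<lambda>(k, l). fourier_coeff N \<phi> (index2 (i - k, j - l)))"
  define m where "m \<alpha> = monomial N (\<lambda>n. - \<alpha> n)" for \<alpha>
  define u where "u \<zeta> = \<phi> \<zeta> * m (index2 (i, j)) \<zeta> - (\<Sum>v\<in>?B. c v * m (index2 v) \<zeta>)" for \<zeta>
  have mL2: "m \<alpha> \<in> L2 N" for \<alpha> unfolding m_def by (rule monomial_L2)
  have \<phi>m: "(\<lambda>\<zeta>. \<phi> \<zeta> * m \<alpha> \<zeta>) \<in> L2 N" for \<alpha>
    using L2_mult_bounded[OF H2_L2[OF \<phi>], of "m \<alpha>" 1]
    by (simp add: m_def mult.commute norm_monomial)
  have uL2: "u \<in> L2 N"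
    unfolding u_def by (intro L2_diff \<phi>m L2_sum L2_scale mL2)
  have expand: "(LINT \<zeta>|torus N. h \<zeta> * u \<zeta>) = (LINT \<zeta>|torus N. h \<zeta> * (\<phi> \<zeta> * m (index2 (i, j)) \<zeta>))
      - (\<Sum>v\<in>?B. c v * (LINT \<zeta>|torus N. h \<zeta> * m (index2 v) \<zeta>))" if h: "h \<in> L2 N" for h
  proof -
    have "(LINT \<zeta>|torus N. h \<zeta> * u \<zeta>) = (LINT \<zeta>|torus N. h \<zeta> * (\<phi> \<zeta> * m (index2 (i, j)) \<zeta>)
        - (\<Sum>v\<in>?B. c v * (h \<zeta> * m (index2 v) \<zeta>)))"
      by (simp add: u_def right_diff_distrib sum_distrib_left mult.left_commute)
    also have "\<dots> = (LINT \<zeta>|torus N. h \<zeta> * (\<phi> \<zeta> * m (index2 (i, j)) \<zeta>))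
        - (LINT \<zeta>|torus N. (\<Sum>v\<in>?B. c v * (h \<zeta> * m (index2 v) \<zeta>)))"
      by (intro Bochner_Integration.integral_diff Bochner_Integration.integrable_sum
          integrable_mult_right integrable_L2_mult h \<phi>m mL2)
    also have "(LINT \<zeta>|torus N. (\<Sum>v\<in>?B. c v * (h \<zeta> * m (index2 v) \<zeta>)))
        = (\<Sum>v\<in>?B. (LINT \<zeta>|torus N. c v * (h \<zeta> * m (index2 v) \<zeta>)))"
      by (intro Bochner_Integration.integral_sum integrable_mult_right integrable_L2_mult h mL2)
    finally show ?thesis by simp
  qed
  have "(LINT \<zeta>|torus N. g \<zeta> * u \<zeta>) = 0"
  proof (rule H2_integral_mult_eq_0[OF g uL2])
    fix \<gamma> assume \<gamma>: "\<gamma> \<in> nonneg_indices N"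
    have first: "(LINT \<zeta>|torus N. monomial N \<gamma> \<zeta> * (\<phi> \<zeta> * m (index2 (i, j)) \<zeta>))
        = fourier_coeff N \<phi> (\<lambda>n. index2 (i, j) n - \<gamma> n)"
      unfolding m_def by (rule fourier_coeff_monomial_mult)
    have second: "(LINT \<zeta>|torus N. monomial N \<gamma> \<zeta> * m (index2 v) \<zeta>)
        = (if \<forall>n<N. \<gamma> n = index2 v n then 1 else 0)" for v
      unfolding m_def integral_monomial_mult by simp
    have "fourier_coeff N \<phi> (\<lambda>n. index2 (i, j) n - \<gamma> n)
        = (\<Sum>v\<in>?B. if \<forall>n<N. \<gamma> n = index2 v n then c v else 0)"
    proof (cases "\<exists>v\<in>?B. \<forall>n<N. \<gamma> n = index2 v n")
      case True
      then obtain v where v: "v \<in> ?B" "\<forall>n<N. \<gamma> n = index2 v n" by blast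
      have "(\<forall>n<N. \<gamma> n = index2 w n) \<longleftrightarrow> w = v" for w
        using v(2) index2_eq_iff[OF N, of w v] by metis
      then have "(\<Sum>w\<in>?B. if \<forall>n<N. \<gamma> n = index2 w n then c w else 0) = c v"
        using v(1) by simp
      also have "c v = fourier_coeff N \<phi> (\<lambda>n. index2 (i, j) n - \<gamma> n)"
        unfolding c_def case_prod_unfold
        by (rule fourier_coeff_cong) (use v in \<open>auto simp: index2_def of_nat_diff\<close>)
      finally show ?thesis ..
    next
      case False
      have "\<exists>n<N. index2 (i, j) n - \<gamma> n < 0"
      proof (rule ccontr)
        assume "\<not> ?thesis"
        then have le: "\<gamma> n \<le> index2 (i, j) n" "0 \<le> \<gamma> n" if "n < N" for n
          using that \<gamma> unfolding nonneg_indices_def by (metis diff_ge_0_iff_ge not_le mem_Collect_eq)+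
        have bounds: "\<gamma> 0 \<le> int i" "\<gamma> 1 \<le> int j" "0 \<le> \<gamma> 0" "0 \<le> \<gamma> 1"
          using le[of 0] le[of 1] N by (auto simp: index2_def)
        let ?v = "(nat (\<gamma> 0), nat (\<gamma> 1))"
        have "\<gamma> n = index2 ?v n" if "n < N" for n
          using le[OF that] bounds by (auto simp: index2_def split: if_splits)
        moreover have "?v \<in> ?B"
          using bounds by (simp add: nat_le_iff)
        ultimately show False
          using False by blast
      qed
      then obtain n where "n < N" "index2 (i, j) n - \<gamma> n < 0" by blast
      then have "fourier_coeff N \<phi> (\<lambda>n. index2 (i, j) n - \<gamma> n) = 0"
        by (rule H2_fourier_coeff[OF \<phi>])
      moreover have "(\<Sum>v\<in>?B. if \<forall>n<N. \<gamma> n = index2 v n then c v else 0) = 0"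
        using False by (intro sum.neutral) auto
      ultimately show ?thesis by simp
    qed
    then show "(LINT \<zeta>|torus N. monomial N \<gamma> \<zeta> * u \<zeta>) = 0"
      unfolding expand[OF monomial_L2] first second by (simp add: if_distrib[of "(*) _"] cong: if_cong)
  qed
  then have "(LINT \<zeta>|torus N. g \<zeta> * (\<phi> \<zeta> * m (index2 (i, j)) \<zeta>))
      = (\<Sum>v\<in>?B. c v * (LINT \<zeta>|torus N. g \<zeta> * m (index2 v) \<zeta>))"
    unfolding expand[OF H2_L2[OF g]] by simp
  then show ?thesis
    by (simp add: fourier_coeff_def mult_op_def m_def c_def case_prod_unfold mult_ac)
qed

section \<open>Polynomials of bounded degree in two of the variables\<close>

definition triangle_indices :: "nat \<Rightarrow> (nat \<times> nat) set" where
  "triangle_indices d = {(i, j). i + j < d}"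

lemma finite_triangle: "finite (triangle_indices d)"
  by (rule finite_subset[of _ "{..<d} \<times> {..<d}"]) (auto simp: triangle_indices_def)

lemma card_triangle_Suc: "card (triangle_indices (Suc d)) = card (triangle_indices d) + Suc d"
proof -
  have "triangle_indices (Suc d) = triangle_indices d \<union> (\<lambda>i. (i, d - i)) ` {..d}"
    by (auto simp: triangle_indices_def image_iff)
  moreover have "triangle_indices d \<inter> (\<lambda>i. (i, d - i)) ` {..d} = {}"
    by (auto simp: triangle_indices_def)
  moreover have "card ((\<lambda>i. (i, d - i)) ` {..d}) = Suc d"
    by (subst card_image) (auto simp: inj_on_def)
  ultimately show ?thesis
    by (simp add: card_Un_disjoint finite_triangle)
qed

definition poly2 :: "nat \<Rightarrow> (nat \<times> nat) set \<Rightarrow> (nat \<times> nat \<Rightarrow> complex) \<Rightarrow> (nat \<Rightarrow> complex) \<Rightarrow> complex" where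
  "poly2 N U c \<zeta> = (\<Sum>u\<in>U. c u * monomial N (index2 u) \<zeta>)"

lemma poly2_H2: "poly2 N U c \<in> H2 N"
proof -
  have "trig_poly N (nonneg_indices N) (\<lambda>\<zeta>. \<Sum>u\<in>U. c u * monomial N (index2 u) \<zeta>)"
    by (induction U rule: infinite_finite_induct)
       (simp_all add: trig_poly.zero trig_poly.add_term index2_nonneg)
  from analytic_trig_poly_H2[OF this] show ?thesis
    unfolding poly2_def[abs_def] .
qed

lemma L2_inner_poly2:
  assumes h: "h \<in> L2 N"
  shows "L2_inner N (poly2 N U c) h = (\<Sum>u\<in>U. c u * cnj (fourier_coeff N h (index2 u)))"
proof -
  have cnj: "cnj (fourier_coeff N h \<alpha>) = (LINT \<zeta>|torus N. monomial N \<alpha> \<zeta> * cnj (h \<zeta>))" for \<alpha>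
  proof -
    have "cnj (fourier_coeff N h \<alpha>) = (LINT \<zeta>|torus N. cnj (h \<zeta> * monomial N (\<lambda>j. - \<alpha> j) \<zeta>))"
      unfolding fourier_coeff_def by (rule Bochner_Integration.integral_cnj[symmetric])
    also have "\<dots> = (LINT \<zeta>|torus N. monomial N \<alpha> \<zeta> * cnj (h \<zeta>))"
      by (rule Bochner_Integration.integral_cong) (simp_all add: monomial_cnj mult.commute)
    finally show ?thesis .
  qed
  have "L2_inner N (poly2 N U c) h
      = (LINT \<zeta>|torus N. (\<Sum>u\<in>U. c u * (monomial N (index2 u) \<zeta> * cnj (h \<zeta>))))"
    unfolding L2_inner_def poly2_def by (simp add: sum_distrib_right mult.assoc)
  also have "\<dots> = (\<Sum>u\<in>U. (LINT \<zeta>|torus N. c u * (monomial N (index2 u) \<zeta> * cnj (h \<zeta>))))"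
    by (intro Bochner_Integration.integral_sum integrable_mult_right integrable_L2_mult monomial_L2
        L2_cnj h)
  finally show ?thesis by (simp add: cnj)
qed

lemma L2_inner_poly2_self:
  assumes N: "N > 1" and U: "finite U"
  shows "L2_inner N (poly2 N U c) (poly2 N U c) = of_real (\<Sum>u\<in>U. (cmod (c u))\<^sup>2)"
proof -
  have "fourier_coeff N (poly2 N U c) (index2 v) = c v" if v: "v \<in> U" for v
  proof -
    have "fourier_coeff N (poly2 N U c) (index2 v)
        = (LINT \<zeta>|torus N. (\<Sum>u\<in>U. c u * (monomial N (index2 u) \<zeta> * monomial N (\<lambda>n. - index2 v n) \<zeta>)))"
      unfolding fourier_coeff_def poly2_def by (simp add: sum_distrib_right mult.assoc)
    also have "\<dots> = (\<Sum>u\<in>U. (LINT \<zeta>|torus N. c u * (monomial N (index2 u) \<zeta> * monomial N (\<lambda>n. - index2 v n) \<zeta>)))"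
      by (intro Bochner_Integration.integral_sum integrable_mult_right integrable_L2_mult monomial_L2)
    also have "\<dots> = (\<Sum>u\<in>U. if u = v then c u else 0)"
      using index2_eq_iff[OF N] by (intro sum.cong) (auto simp: integral_monomial_mult)
    finally show ?thesis using v U by simp
  qed
  then show ?thesis
    unfolding L2_inner_poly2[OF H2_L2[OF poly2_H2]]
    by (simp add: complex_norm_square del: of_real_power)
qed

text \<open>For \<open>y = poly2 N (triangle_indices (Suc d)) c\<close> the assumption on \<open>c\<close> says that
  the adjoint of multiplication by \<open>\<phi> - \<lambda>\<close>, with \<open>\<lambda>\<close> the constant coefficient of \<open>\<phi>\<close>, annihilates
  \<open>y\<close>: the coefficient of the image at \<open>(k, l)\<close> involves only the \<open>c (i, j)\<close> with
  \<open>(i, j)\<close> above and different from \<open>(k, l)\<close>. For \<open>k + l = d\<close> there are no such \<open>(i, j)\<close>,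
  so only the \<open>(k, l)\<close> of the smaller triangle contribute equations.\<close>

lemma poly2_joint_eigenvector:
  assumes N: "N > 1" and \<phi>: "\<phi> \<in> H2 N" and g: "g \<in> H2 N" and \<phi>g: "mult_op \<phi> g \<in> L2 N"
    and c: "\<And>k l. (k, l) \<in> triangle_indices d \<Longrightarrow>
      (\<Sum>(i, j)\<in>triangle_indices (Suc d). (if k \<le> i \<and> l \<le> j \<and> (i, j) \<noteq> (k, l)
        then cnj (fourier_coeff N \<phi> (index2 (i - k, j - l))) else 0) * c (i, j)) = 0"
  shows "L2_inner N (poly2 N (triangle_indices (Suc d)) c) (mult_op \<phi> g)
    = cnj (fourier_coeff N \<phi> (index2 (0, 0))) * L2_inner N (poly2 N (triangle_indices (Suc d)) c) g"
proof -
  let ?T = "triangle_indices (Suc d)"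
  define a where "a u = cnj (fourier_coeff N \<phi> (index2 u))" for u
  define b where "b u = cnj (fourier_coeff N g (index2 u))" for u
  have diag: "(\<Sum>(i, j)\<in>?T. (if k \<le> i \<and> l \<le> j then a (i - k, j - l) else 0) * c (i, j)) = a (0, 0) * c (k, l)"
    if kl: "(k, l) \<in> ?T" for k l
  proof -
    have off: "(\<Sum>(i, j)\<in>?T. (if k \<le> i \<and> l \<le> j \<and> (i, j) \<noteq> (k, l) then a (i - k, j - l) else 0) * c (i, j)) = 0"
    proof (cases "(k, l) \<in> triangle_indices d")
      case True
      from c[OF this] show ?thesis by (simp add: a_def cong: if_cong)
    next
      case False
      show ?thesis
        by (rule sum.neutral) (use kl False in \<open>auto simp: triangle_indices_def\<close>)
    qed
    have "(\<Sum>(i, j)\<in>?T. (if k \<le> i \<and> l \<le> j then a (i - k, j - l) else 0) * c (i, j))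
        = (\<Sum>u\<in>?T. (if u = (k, l) then a (0, 0) * c u else 0) + (case u of (i, j) \<Rightarrow>
            (if k \<le> i \<and> l \<le> j \<and> (i, j) \<noteq> (k, l) then a (i - k, j - l) else 0) * c (i, j)))"
      by (intro sum.cong) (auto split: if_splits)
    also have "\<dots> = a (0, 0) * c (k, l)"
      unfolding sum.distrib off using kl by (simp add: finite_triangle)
    finally show ?thesis .
  qed
  have coeff: "cnj (fourier_coeff N (mult_op \<phi> g) (index2 (i, j)))
      = (\<Sum>(k, l)\<in>?T. (if k \<le> i \<and> l \<le> j then a (i - k, j - l) else 0) * b (k, l))"
    if ij: "(i, j) \<in> ?T" for i j
  proof -
    have "cnj (fourier_coeff N (mult_op \<phi> g) (index2 (i, j)))
        = (\<Sum>(k, l)\<in>{..i} \<times> {..j}. a (i - k, j - l) * b (k, l))"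
      unfolding fourier_coeff_mult[OF N \<phi> g] by (simp add: a_def b_def case_prod_unfold)
    also have "\<dots> = (\<Sum>(k, l)\<in>?T. (if k \<le> i \<and> l \<le> j then a (i - k, j - l) else 0) * b (k, l))"
      by (rule sum.mono_neutral_cong_left) (use ij finite_triangle[of "Suc d"] in \<open>auto simp: triangle_indices_def split: if_splits\<close>)
    finally show ?thesis .
  qed
  have "L2_inner N (poly2 N ?T c) (mult_op \<phi> g)
      = (\<Sum>(i, j)\<in>?T. c (i, j) * (\<Sum>(k, l)\<in>?T. (if k \<le> i \<and> l \<le> j then a (i - k, j - l) else 0) * b (k, l)))"
    unfolding L2_inner_poly2[OF \<phi>g] by (intro sum.cong refl) (auto simp: coeff)
  also have "\<dots> = (\<Sum>(k, l)\<in>?T. b (k, l) * (\<Sum>(i, j)\<in>?T. (if k \<le> i \<and> l \<le> j then a (i - k, j - l) else 0) * c (i, j)))"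
    unfolding case_prod_unfold sum_distrib_left by (subst sum.swap) (simp add: mult_ac)
  also have "\<dots> = (\<Sum>(k, l)\<in>?T. b (k, l) * (a (0, 0) * c (k, l)))"
    by (intro sum.cong refl) (auto simp: diag)
  also have "\<dots> = a (0, 0) * (\<Sum>u\<in>?T. c u * b u)"
    unfolding case_prod_unfold sum_distrib_left by (simp add: mult_ac)
  finally show ?thesis
    unfolding L2_inner_poly2[OF H2_L2[OF g]] a_def b_def .
qed

section \<open>Orbits of finitely many vectors\<close>

theorem proposition2p5:
  fixes N :: nat and \<phi> :: "(nat \<Rightarrow> complex) \<Rightarrow> complex"
  assumes "N > 1" and "\<phi> \<in> Hinfty N"
  shows "\<not> (\<exists>(I :: 'i set) (f :: 'i \<Rightarrow> (nat \<Rightarrow> complex) \<Rightarrow> complex).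
             finite I \<and> (\<forall>i\<in>I. f i \<in> H2 N) \<and>
             is_frame (H2 N) (L2_inner N) (I \<times> (UNIV :: nat set))
               (\<lambda>(i, n). (mult_op \<phi> ^^ n) (f i)))"
proof
  assume "\<exists>(I :: 'i set) (f :: 'i \<Rightarrow> (nat \<Rightarrow> complex) \<Rightarrow> complex).
             finite I \<and> (\<forall>i\<in>I. f i \<in> H2 N) \<and>
             is_frame (H2 N) (L2_inner N) (I \<times> (UNIV :: nat set))
               (\<lambda>(i, n). (mult_op \<phi> ^^ n) (f i))"
  then obtain I :: "'i set" and f where I: "finite I" and f: "\<And>i. i \<in> I \<Longrightarrow> f i \<in> H2 N"
    and frame: "is_frame (H2 N) (L2_inner N) (I \<times> (UNIV :: nat set)) (\<lambda>(i, n). (mult_op \<phi> ^^ n) (f i))"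
    by blast
  have \<phi>: "\<phi> \<in> H2 N" using assms(2) by (simp add: Hinfty_def)
  have orbit: "(mult_op \<phi> ^^ n) (f i) \<in> H2 N" if "i \<in> I" for i n
    using frame that unfolding is_frame_def by auto
  obtain A where A: "A > 0" and lower: "\<And>y. y \<in> H2 N \<Longrightarrow> A * Re (L2_inner N y y)
      \<le> (\<Sum>\<^sub>\<infinity>(i, n)\<in>I \<times> (UNIV :: nat set). (cmod (L2_inner N y ((mult_op \<phi> ^^ n) (f i))))\<^sup>2)"
    using frame unfolding is_frame_def case_prod_unfold by blast
  define d where "d = card I"
  let ?T = "triangle_indices (Suc d)"
  \<comment> \<open>The equations indexed by the smaller triangle make the solution an eigenvector of the adjoint; those indexed by \<open>I\<close> make it orthogonal to the generators.\<close>
  define M where "M = (\<lambda>w (i, j). case w of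
      Inl (k, l) \<Rightarrow> if k \<le> i \<and> l \<le> j \<and> (i, j) \<noteq> (k, l)
        then cnj (fourier_coeff N \<phi> (index2 (i - k, j - l))) else 0
    | Inr p \<Rightarrow> cnj (fourier_coeff N (f p) (index2 (i, j))))"
  \<comment> \<open>The larger triangle has \<open>d + 1\<close> more points than the smaller one, and \<open>I\<close> has \<open>d\<close> elements.\<close>
  have "card (triangle_indices d <+> I) < card ?T"
    by (simp add: card_Plus finite_triangle I card_triangle_Suc d_def)
  then obtain c where c: "\<exists>u\<in>?T. c u \<noteq> 0" "\<And>w. w \<in> triangle_indices d <+> I \<Longrightarrow> (\<Sum>u\<in>?T. M w u * c u) = 0"
    using homogeneous_system_nontrivial[of "triangle_indices d <+> I" ?T M] I
    by (auto simp: finite_triangle simp del: Plus_def)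
  define y where "y = poly2 N ?T c"
  have y: "y \<in> H2 N" unfolding y_def by (rule poly2_H2)
  have zero: "L2_inner N y ((mult_op \<phi> ^^ n) (f i)) = 0" if i: "i \<in> I" for i n
  proof (induction n)
    case 0
    have "(\<Sum>u\<in>?T. M (Inr i) u * c u) = 0" by (rule c(2)) (use i in auto)
    then show ?case
      unfolding y_def funpow_0 L2_inner_poly2[OF H2_L2[OF f[OF i]]]
      by (simp add: M_def case_prod_unfold mult.commute)
  next
    case (Suc n)
    have "L2_inner N y (mult_op \<phi> ((mult_op \<phi> ^^ n) (f i)))
        = cnj (fourier_coeff N \<phi> (index2 (0, 0))) * L2_inner N y ((mult_op \<phi> ^^ n) (f i))"
      unfolding y_def
    proof (rule poly2_joint_eigenvector[OF assms(1) \<phi> orbit[OF i]])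
      show "mult_op \<phi> ((mult_op \<phi> ^^ n) (f i)) \<in> L2 N"
        using H2_L2[OF orbit[OF i, of "Suc n"]] by simp
      fix k l assume "(k, l) \<in> triangle_indices d"
      then have "(\<Sum>u\<in>?T. M (Inl (k, l)) u * c u) = 0" by (intro c(2)) auto
      then show "(\<Sum>(i, j)\<in>?T. (if k \<le> i \<and> l \<le> j \<and> (i, j) \<noteq> (k, l)
        then cnj (fourier_coeff N \<phi> (index2 (i - k, j - l))) else 0) * c (i, j)) = 0"
        by (simp add: M_def case_prod_unfold prod_eq_iff cong: if_cong)
    qed
    with Suc show ?case by simp
  qed
  have "(\<Sum>\<^sub>\<infinity>(i, n)\<in>I \<times> (UNIV :: nat set). (cmod (L2_inner N y ((mult_op \<phi> ^^ n) (f i))))\<^sup>2) = 0"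
    by (rule infsum_0) (auto simp: zero)
  with lower[OF y] have "A * Re (L2_inner N y y) \<le> 0" by simp
  moreover have "Re (L2_inner N y y) > 0"
  proof -
    have "(\<Sum>u\<in>?T. (cmod (c u))\<^sup>2) > 0"
      using c(1) by (auto intro!: sum_pos2 finite_triangle)
    then show ?thesis
      unfolding y_def L2_inner_poly2_self[OF assms(1) finite_triangle] by simp
  qed
  ultimately show False
    using A by (simp add: mult_le_0_iff)
qed

end
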